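(* (Direct part) Let $K$ be a Valdivia compact space with $w(K)\le\omega_1$ and let $S$ be a dense $\Sigma$-subset of $K$. Then there exist an $\omega_1$-graded tree $(T,\delta)$, a compatible topology on $P^*(T)$ such that $P^*(T_\alpha)$ is metrizable for all $\alpha\in\omega_1$, and a homeomorphism between $K$ and $P^*(T)$ that carries $S$ to the set $$\bigcup_{\alpha\in\omega_1}P^*(T_\alpha)=\big\{A\in P^*(T):\vert A\vert\le\omega\big\}.\qquad( * )$$ (Converse part) Conversely, given an $\omega_1$-graded tree $(T,\delta)$ and a compatible topology on $P^*(T)$ such that $P^*(T_\alpha)$ is metrizable for all $\alpha\in\omega_1$, then $K=P^*(T)$ is a Valdivia compact space with $w(K)\le\omega_1$ and the set $( * )$ is a dense $\Sigma$-subset of $K$.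
   Context: Valdivia compacta: for an index set $\Gamma$, $\Sigma(\Gamma)$ is the set of $x\in\mathbb{R}^\Gamma$ such that $\{\gamma\in\Gamma:x_\gamma\ne0\}$ is countable; $\mathbb{R}^\Gamma$ has the product topology. A $\Sigma$-subset of a compact Hausdorff space $K$ is a subset of the form $\varphi^{-1}[\Sigma(\Gamma)]$, where $\Gamma$ is some index set and $\varphi:K\to\mathbb{R}^\Gamma$ is a continuous injection. $K$ is a Valdivia compactum (Valdivia compact space) if it is compact Hausdorff and admits a dense $\Sigma$-subset. $w(K)$ is the weight of $K$ and $\vert\cdot\vert$ denotes cardinality. Trees: a tree is a partially ordered set $(T,\le)$ such that for all $t\in T$ the set $\{s\in T:s<t\}$ is well-ordered. An initial part of $T$ is a subset $X\subset T$ with $\{s\in T:s<t\}\subset X$ for all $t\in X$; an initial part with the restricted order is called an initial subtree. A path of $T$ is a subset that is totally ordered and an initial part of $T$. $P^*(T)$ is the set of nonempty paths of $T$. If $Z$ is an initial subtree of $T$, the paths of $Z$ are the paths of $T$ contained in $Z$, so $P^*(Z)\subset P^*(T)$. Graded trees: $\mathbb{S}$ is the class of successor ordinals. A graded tree $(T,\delta)$ is a tree $T$ with a map $\delta:T\to\mathbb{S}\cup\{0\}$ such that $\delta(t)=0$ for every minimal $t\in T$ and $\delta(t)<\delta(s)$ whenever $t<s$. For an ordinal $\alpha$, $T_\alpha=\{t\in T:\delta(t)\le\alpha\}$ (an initial subtree) and $\rho_\alpha:P^*(T)\to P^*(T_\alpha)$ is $\rho_\alpha(A)=A\cap T_\alpha$.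 A compatible topology on $P^*(T)$ is a compact Hausdorff topology on $P^*(T)$ such that $\rho_\alpha:P^*(T)\to P^*(T)$ is continuous for every ordinal $\alpha$; each $P^*(T_\alpha)$ then carries the subspace topology. For a nonzero ordinal $\theta$, $(T,\delta)$ is $\theta$-graded if $\delta(t)<\theta$ for all $t\in T$. *)

theory Defs
  imports "HOL-Analysis.Analysis"
begin

unbundle cardinal_syntax

section \<open>Ordinals\<close>

text \<open>HOL has no type of all ordinals. The following type consists of the order types of all
  well-orders on subsets of \<^typ>\<open>nat set\<close>, i.e. of all ordinals of cardinality at most that of the
  continuum. In particular it contains \<open>\<omega>\<^sub>1\<close> together with all ordinals below it.\<close>

quotient_type ordinal = "nat set rel" / partial: "\<lambda>r s. Well_order r \<and> Well_order s \<and> r =o s"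
proof (rule part_equivpI)
  show "\<exists>r :: nat set rel. Well_order r \<and> Well_order r \<and> r =o r"
    using card_of_Well_order ordIso_reflexive by blast
  show "symp (\<lambda>r s :: nat set rel. Well_order r \<and> Well_order s \<and> r =o s)"
    by (auto intro!: sympI intro: ordIso_symmetric)
  show "transp (\<lambda>r s :: nat set rel. Well_order r \<and> Well_order s \<and> r =o s)"
    by (auto intro!: transpI intro: ordIso_transitive)
qed

instantiation ordinal :: "{wellorder, zero}"
begin

lift_definition less_eq_ordinal :: "ordinal \<Rightarrow> ordinal \<Rightarrow> bool" is "\<lambda>r s. r \<le>o s"
  by (meson ordIso_ordLeq_trans ordIso_symmetric ordLeq_ordIso_trans)

lift_definition less_ordinal :: "ordinal \<Rightarrow> ordinal \<Rightarrow> bool" is "\<lambda>r s. r <o s"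
  by (meson ordIso_ordLess_trans ordIso_symmetric ordLess_ordIso_trans)

lift_definition zero_ordinal :: ordinal is "{}"
  by (auto intro: ordIso_reflexive)

instance
proof
  fix x y z :: ordinal
  show "x < y \<longleftrightarrow> x \<le> y \<and> \<not> y \<le> x"
    by transfer (metis not_ordLeq_iff_ordLess ordLess_imp_ordLeq)
  show "x \<le> x"
    by transfer (auto intro: ordLeq_reflexive)
  show "x \<le> y \<Longrightarrow> y \<le> z \<Longrightarrow> x \<le> z"
    by transfer (auto intro: ordLeq_transitive)
  show "x \<le> y \<Longrightarrow> y \<le> x \<Longrightarrow> x = y"
    by transfer (auto simp: ordIso_iff_ordLeq)
  show "x \<le> y \<or> y \<le> x"
    by transfer (use ordLeq_total in blast)
next
  fix P :: "ordinal \<Rightarrow> bool" and a :: ordinal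
  assume step: "\<And>x. (\<And>y. y < x \<Longrightarrow> P y) \<Longrightarrow> P x"
  have "wf {(x :: ordinal, y). x < y}"
  proof (rule wf_subset)
    show "wf (inv_image (ordLess :: (nat set rel \<times> nat set rel) set) rep_ordinal)"
      using wf_ordLess by (rule wf_inv_image)
    show "{(x, y). x < y} \<subseteq> inv_image ordLess rep_ordinal"
      by (auto simp: less_ordinal.rep_eq inv_image_def)
  qed
  then show "P a"
    by (induction a rule: wf_induct_rule) (auto intro: step)
qed

end

lift_definition omega1 :: ordinal ("\<omega>\<^sub>1") is "cardSuc natLeq"
  using cardSuc_Card_order[OF natLeq_Card_order]
  by (auto simp: card_order_on_def intro: ordIso_reflexive)

lemma zero_le_ordinal: "(0 :: ordinal) \<le> a"
  by transfer (auto simp: ordLeq_def embed_def)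

definition successor_ordinal :: "ordinal \<Rightarrow> bool" where
  "successor_ordinal a \<longleftrightarrow> (\<exists>b < a. \<forall>c < a. c \<le> b)"


section \<open>Weight of a topological space\<close>

definition topology_base :: "'a topology \<Rightarrow> 'a set set \<Rightarrow> bool" where
  "topology_base X B \<longleftrightarrow> (\<forall>V\<in>B. openin X V) \<and>
     (\<forall>U x. openin X U \<and> x \<in> U \<longrightarrow> (\<exists>V\<in>B. x \<in> V \<and> V \<subseteq> U))"

text \<open>A cardinal is represented, as usual in HOL, by a well-order, here by \<open>|B|\<close> for a base \<open>B\<close> of
  minimal cardinality; it is unique up to \<open>=o\<close>.\<close>

definition weight :: "'a topology \<Rightarrow> 'a set rel" where
  "weight X = (SOME r. (\<exists>B. topology_base X B \<and> r = |B| ) \<and>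
                        (\<forall>B. topology_base X B \<longrightarrow> r \<le>o |B| ))"


lemma weight_le_iff: "weight X \<le>o c \<longleftrightarrow> (\<exists>B. topology_base X B \<and> |B| \<le>o c)"
proof -
  have "topology_base X {U. openin X U}"
    by (auto simp: topology_base_def)
  then have ne: "card_of ` Collect (topology_base X) \<noteq> {}" by blast
  obtain r where "r \<in> card_of ` Collect (topology_base X)"
    "\<forall>r' \<in> card_of ` Collect (topology_base X). r \<le>o r'"
    using exists_minim_Well_order[OF ne] by (auto intro: card_of_Well_order)
  then have "\<exists>r. (\<exists>B. topology_base X B \<and> r = |B| ) \<and> (\<forall>B. topology_base X B \<longrightarrow> r \<le>o |B| )"
    by blast
  from someI_ex[OF this, folded weight_def] show ?thesis
    by (metis ordLeq_transitive)
qed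


section \<open>Valdivia compacta\<close>

definition Sigma_product :: "'i set \<Rightarrow> ('i \<Rightarrow> real) set" where
  "Sigma_product \<Gamma> = {x \<in> topspace (powertop_real \<Gamma>). countable {\<gamma> \<in> \<Gamma>. x \<gamma> \<noteq> 0}}"

definition Sigma_subset_via :: "'i set \<Rightarrow> 'a topology \<Rightarrow> 'a set \<Rightarrow> bool" where
  "Sigma_subset_via \<Gamma> K S \<longleftrightarrow>
     (\<exists>\<phi>. continuous_map K (powertop_real \<Gamma>) \<phi> \<and> inj_on \<phi> (topspace K) \<and>
          S = {x \<in> topspace K. \<phi> x \<in> Sigma_product \<Gamma>})"

text \<open>The index set is an arbitrary set. As one cannot quantify over types, a fixed index type has
  to be chosen; by lemma \<open>Sigma_subsetI\<close> below the one used here is large enough for every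
  \<open>\<Sigma>\<close>-subset.\<close>

definition Sigma_subset :: "'a topology \<Rightarrow> 'a set \<Rightarrow> bool" where
  "Sigma_subset K S \<longleftrightarrow> (\<exists>\<Gamma> :: (('a \<Rightarrow> real) \<times> real) set. Sigma_subset_via \<Gamma> K S)"

lemma Sigma_subsetI:
  fixes K :: "'a topology" and \<Gamma> :: "'i set"
  assumes "Sigma_subset_via \<Gamma> K S"
  shows "Sigma_subset K S"
proof -
  obtain \<phi> where cont: "continuous_map K (powertop_real \<Gamma>) \<phi>"
    and inj: "inj_on \<phi> (topspace K)"
    and S: "S = {x \<in> topspace K. \<phi> x \<in> Sigma_product \<Gamma>}"
    using assms unfolding Sigma_subset_via_def by blast
  define coord where "coord = (\<lambda>\<gamma> x. \<phi> x \<gamma>)"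
  define fib where "fib = (\<lambda>f. {\<gamma> \<in> \<Gamma>. coord \<gamma> = f})"
  define M where "M = (\<lambda>f. if countable (fib f) then {0 :: real} else UNIV)"
  define \<Gamma>' where "\<Gamma>' = Sigma (coord ` \<Gamma>) M"
  define \<psi> where "\<psi> = (\<lambda>x. restrict (\<lambda>p. fst p x) \<Gamma>')"
  have M: "M f \<noteq> {}" "countable (M f) \<longleftrightarrow> countable (fib f)" for f
    using uncountable_UNIV_real by (auto simp: M_def)
  have ext: "\<phi> x \<in> extensional \<Gamma>" if "x \<in> topspace K" for x
    using continuous_map_image_subset_topspace[OF cont] that by (auto simp: PiE_def)
  have "continuous_map K euclideanreal (coord \<gamma>)" if "\<gamma> \<in> \<Gamma>" for \<gamma>
    using cont that by (auto simp: continuous_map_componentwise coord_def)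
  then have cont': "continuous_map K (powertop_real \<Gamma>') \<psi>"
    by (auto simp: continuous_map_componentwise \<psi>_def \<Gamma>'_def)
  have inj': "inj_on \<psi> (topspace K)"
  proof (rule inj_onI)
    fix x y assume xy: "x \<in> topspace K" "y \<in> topspace K" "\<psi> x = \<psi> y"
    have "\<phi> x \<gamma> = \<phi> y \<gamma>" if "\<gamma> \<in> \<Gamma>" for \<gamma>
    proof -
      obtain m where "m \<in> M (coord \<gamma>)" using M(1) by blast
      then have "(coord \<gamma>, m) \<in> \<Gamma>'" using that by (auto simp: \<Gamma>'_def)
      then show ?thesis using fun_cong[OF xy(3), of "(coord \<gamma>, m)"] by (simp add: \<psi>_def coord_def)
    qed
    then have "\<phi> x = \<phi> y" using ext xy(1,2) by (meson extensionalityI)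
    then show "x = y" using inj xy(1,2) by (meson inj_onD)
  qed
  have count: "countable {\<gamma> \<in> \<Gamma>. \<phi> x \<gamma> \<noteq> 0} \<longleftrightarrow> countable {p \<in> \<Gamma>'. \<psi> x p \<noteq> 0}" for x
  proof -
    define D where "D = {f \<in> coord ` \<Gamma>. f x \<noteq> 0}"
    have L: "{\<gamma> \<in> \<Gamma>. \<phi> x \<gamma> \<noteq> 0} = (\<Union>f\<in>D. fib f)" (is "?L = _")
    proof -
      have "?L = {\<gamma> \<in> \<Gamma>. coord \<gamma> x \<noteq> 0}" by (simp add: coord_def)
      also have "\<dots> = (\<Union>f\<in>D. fib f)" by (auto simp: D_def fib_def)
      finally show ?thesis .
    qed
    have R: "{p \<in> \<Gamma>'. \<psi> x p \<noteq> 0} = Sigma D M" (is "?R = _")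
      by (auto simp: D_def \<Gamma>'_def \<psi>_def)
    have DL: "D = coord ` ?L" by (auto simp: D_def coord_def)
    have DR: "D = fst ` ?R"
      by (simp add: R fst_image_Sigma M(1))
    have "countable ?L \<longleftrightarrow> countable D \<and> (\<forall>f\<in>D. countable (fib f))"
    proof
      assume *: "countable ?L"
      have "countable D" by (subst DL) (rule countable_image[OF *])
      moreover have "countable (fib f)" if "f \<in> D" for f
      proof (rule countable_subset[OF _ *])
        show "fib f \<subseteq> ?L" unfolding L using that by blast
      qed
      ultimately show "countable D \<and> (\<forall>f\<in>D. countable (fib f))" by blast
    next
      assume "countable D \<and> (\<forall>f\<in>D. countable (fib f))"
      then show "countable ?L" unfolding L by blast
    qed
    moreover have "countable ?R \<longleftrightarrow> countable D \<and> (\<forall>f\<in>D. countable (M f))"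
    proof
      assume *: "countable ?R"
      have "countable D" by (subst DR) (rule countable_image[OF *])
      moreover have "countable (M f)" if "f \<in> D" for f
      proof -
        have "M f = snd ` (Sigma D M \<inter> {f} \<times> UNIV)" using that by force
        moreover have "countable (Sigma D M \<inter> {f} \<times> UNIV)"
          using * unfolding R by (rule countable_subset[OF Int_lower1])
        ultimately show ?thesis by (metis countable_image)
      qed
      ultimately show "countable D \<and> (\<forall>f\<in>D. countable (M f))" by blast
    next
      assume "countable D \<and> (\<forall>f\<in>D. countable (M f))"
      then show "countable ?R" unfolding R by blast
    qed
    ultimately show ?thesis using M(2) by simp
  qed
  have "\<phi> x \<in> Sigma_product \<Gamma> \<longleftrightarrow> \<psi> x \<in> Sigma_product \<Gamma>'" if "x \<in> topspace K" for x
  proof -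
    have "\<psi> x \<in> extensional \<Gamma>'" by (simp add: \<psi>_def)
    then show ?thesis
      using ext[OF that] by (simp add: Sigma_product_def PiE_def count)
  qed
  then have "S = {x \<in> topspace K. \<psi> x \<in> Sigma_product \<Gamma>'}"
    using S by auto
  then have "Sigma_subset_via \<Gamma>' K S"
    using cont' inj' by (auto simp: Sigma_subset_via_def)
  then show ?thesis by (auto simp: Sigma_subset_def)
qed

definition dense_in :: "'a topology \<Rightarrow> 'a set \<Rightarrow> bool" where
  "dense_in X S \<longleftrightarrow> S \<subseteq> topspace X \<and> X closure_of S = topspace X"

definition Valdivia :: "'a topology \<Rightarrow> bool" where
  "Valdivia K \<longleftrightarrow> compact_space K \<and> Hausdorff_space K \<and> (\<exists>S. Sigma_subset K S \<and> dense_in K S)"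


section \<open>Trees and paths\<close>

text \<open>A tree is a carrier \<open>T\<close> with a reflexive order relation \<open>r\<close>; the set of strict predecessors
  of \<open>t\<close> is \<^term>\<open>underS r t\<close>.\<close>

definition tree :: "'t set \<Rightarrow> 't rel \<Rightarrow> bool" where
  "tree T r \<longleftrightarrow> partial_order_on T r \<and>
     (\<forall>t\<in>T. well_order_on (underS r t) (Restr r (underS r t)))"

definition initial_part :: "'t set \<Rightarrow> 't rel \<Rightarrow> 't set \<Rightarrow> bool" where
  "initial_part T r X \<longleftrightarrow> X \<subseteq> T \<and> (\<forall>t\<in>X. T \<inter> underS r t \<subseteq> X)"

definition path_in :: "'t set \<Rightarrow> 't rel \<Rightarrow> 't set \<Rightarrow> bool" where
  "path_in T r A \<longleftrightarrow> total_on A r \<and> initial_part T r A"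

text \<open>Only the restriction of \<open>r\<close> to \<open>T\<close> matters here. Hence for an initial subtree \<open>Z\<close> of \<open>T\<close>,
  \<open>paths Z r\<close> is the set of nonempty paths of \<open>Z\<close> with the restricted order.\<close>

definition paths :: "'t set \<Rightarrow> 't rel \<Rightarrow> 't set set" where
  "paths T r = {A. path_in T r A \<and> A \<noteq> {}}"

lemma paths_initial_part:
  assumes "initial_part T r Z"
  shows "paths Z r = {A \<in> paths T r. A \<subseteq> Z}"
  using assms unfolding paths_def path_in_def initial_part_def by blast


section \<open>Graded trees\<close>

definition graded_tree :: "'t set \<Rightarrow> 't rel \<Rightarrow> ('t \<Rightarrow> ordinal) \<Rightarrow> bool" where
  "graded_tree T r \<delta> \<longleftrightarrow> tree T r \<and>
     (\<forall>t\<in>T. successor_ordinal (\<delta> t) \<or> \<delta> t = 0) \<and>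
     (\<forall>t\<in>T. underS r t = {} \<longrightarrow> \<delta> t = 0) \<and>
     (\<forall>s\<in>T. \<forall>t\<in>underS r s. \<delta> t < \<delta> s)"

definition graded_tree_below :: "ordinal \<Rightarrow> 't set \<Rightarrow> 't rel \<Rightarrow> ('t \<Rightarrow> ordinal) \<Rightarrow> bool" where
  "graded_tree_below \<theta> T r \<delta> \<longleftrightarrow> graded_tree T r \<delta> \<and> (\<forall>t\<in>T. \<delta> t < \<theta>)"

definition level :: "'t set \<Rightarrow> ('t \<Rightarrow> ordinal) \<Rightarrow> ordinal \<Rightarrow> 't set" where
  "level T \<delta> \<alpha> = {t \<in> T. \<delta> t \<le> \<alpha>}"

lemma initial_part_level:
  assumes "graded_tree T r \<delta>"
  shows "initial_part T r (level T \<delta> \<alpha>)"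
  using assms unfolding graded_tree_def initial_part_def level_def by fastforce

definition path_restriction :: "'t set \<Rightarrow> ('t \<Rightarrow> ordinal) \<Rightarrow> ordinal \<Rightarrow> 't set \<Rightarrow> 't set" where
  "path_restriction T \<delta> \<alpha> A = A \<inter> level T \<delta> \<alpha>"

text \<open>If all values of \<open>\<delta>\<close> are at most \<open>\<alpha>\<close>, then \<open>path_restriction T \<delta> \<alpha>\<close> is the identity on paths.
  So ordinals that are too large for the type \<^typ>\<open>ordinal\<close> would impose no further condition.\<close>

definition compatible_topology ::
    "'t set \<Rightarrow> 't rel \<Rightarrow> ('t \<Rightarrow> ordinal) \<Rightarrow> 't set topology \<Rightarrow> bool" where
  "compatible_topology T r \<delta> X \<longleftrightarrow>
     topspace X = paths T r \<and> compact_space X \<and> Hausdorff_space X \<and>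
     (\<forall>\<alpha>. continuous_map X X (path_restriction T \<delta> \<alpha>))"

end

theory Submission
  imports Defs "HOL-Library.Countable_Set_Type"
begin

text \<open>A Valdivia compactum \<open>K\<close> of weight at most \<open>\<omega>\<^sub>1\<close> with dense \<open>\<Sigma>\<close>-subset \<open>S\<close> is described by at most
  \<open>\<omega>\<^sub>1\<close> coordinates. Exhausting these by an increasing continuous chain of countable sets \<open>A\<^sub>a\<close> such
  that setting the coordinates outside \<open>A\<^sub>a\<close> to zero maps \<open>K\<close> into itself gives commuting retractions
  \<open>r\<^sub>a\<close> with metrizable images whose union is \<open>S\<close>. The nodes of the tree are the points \<open>t \<in> S\<close> for which
  the least \<open>a\<close> with \<open>r\<^sub>a t = t\<close> is zero or a successor, the order is \<open>s \<le> t \<longleftrightarrow> s = r\<^sub>a t\<close> for the grade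
  \<open>a\<close> of \<open>s\<close>, and \<open>x \<in> K\<close> corresponds to the path of all nodes of the form \<open>r\<^sub>a x\<close>. Conversely, on a
  path space the restrictions to levels play the role of the retractions, and the increments of
  countable separating families between consecutive levels embed it into a product of real lines.\<close>

section \<open>The ordinals below the first uncountable ordinal\<close>

lemma abs_ordinal_le_iff:
  "Well_order r \<Longrightarrow> Well_order s \<Longrightarrow> abs_ordinal r \<le> abs_ordinal s \<longleftrightarrow> r \<le>o s"
  by (simp add: less_eq_ordinal.abs_eq ordIso_reflexive)

lemma abs_ordinal_less_iff:
  "Well_order r \<Longrightarrow> Well_order s \<Longrightarrow> abs_ordinal r < abs_ordinal s \<longleftrightarrow> r <o s"
  by (simp add: less_ordinal.abs_eq ordIso_reflexive)

lemma abs_ordinal_cases: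
  obtains r where "Well_order r" "a = abs_ordinal r"
  using Quotient3_rep_reflp[OF Quotient3_ordinal, of a] Quotient3_abs_rep[OF Quotient3_ordinal, of a]
  by force

text \<open>The ordinals below the type of \<open>r\<close> are exactly the types of the proper
  initial segments \<open>Restr r (underS r x)\<close>, and different \<open>x\<close> give segments
  of different type. So \<open>x\<close> in the field corresponds bijectively to an ordinal
  below.\<close>

lemma card_of_lessThan_abs_ordinal:
  assumes r: "Well_order r"
  shows "|{..<abs_ordinal r}| =o |Field r|"
proof -
  define s where "s = (\<lambda>x. Restr r (underS r x))"
  have wo: "Well_order (s x)" for x
    unfolding s_def using r by (rule Well_order_Restr)
  have mono: "s x <o s y" if "(x, y) \<in> r" "x \<noteq> y" "x \<in> Field r" "y \<in> Field r" for x y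
  proof -
    have "trans r" "antisym r" using r by (auto simp: order_on_defs)
    then have "underS r x \<subset> underS r y"
      using that unfolding underS_def by (blast dest: transD antisymD)
    then show ?thesis
      unfolding s_def using r
      by (subst ofilter_subset_ordLess[symmetric]) (auto simp: wo_rel_def wo_rel.underS_ofilter)
  qed
  have "bij_betw (\<lambda>x. abs_ordinal (s x)) (Field r) {..<abs_ordinal r}"
  proof (rule bij_betw_imageI)
    show "inj_on (\<lambda>x. abs_ordinal (s x)) (Field r)"
    proof (rule inj_onI, rule ccontr)
      fix x y assume xy: "x \<in> Field r" "y \<in> Field r" "abs_ordinal (s x) = abs_ordinal (s y)" "x \<noteq> y"
      then have "(x, y) \<in> r \<or> (y, x) \<in> r"
        using r by (auto simp: order_on_defs total_on_def)
      then have "s x <o s y \<or> s y <o s x"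
        using mono xy by metis
      then show False
        using xy(3) wo by (metis abs_ordinal_less_iff less_irrefl)
    qed
    show "(\<lambda>x. abs_ordinal (s x)) ` Field r = {..<abs_ordinal r}"
    proof (intro equalityI subsetI)
      fix a assume "a \<in> (\<lambda>x. abs_ordinal (s x)) ` Field r"
      then show "a \<in> {..<abs_ordinal r}"
        using underS_Restr_ordLess[OF r] wo r by (auto simp: abs_ordinal_less_iff) (auto simp: s_def)
    next
      fix a assume a: "a \<in> {..<abs_ordinal r}"
      obtain r' where r': "Well_order r'" "a = abs_ordinal r'" by (rule abs_ordinal_cases)
      then have "r' <o r" using a r by (simp add: abs_ordinal_less_iff)
      then obtain x where "x \<in> Field r" "r' =o s x"
        using ordLess_iff_ordIso_Restr[OF r r'(1)] unfolding s_def by blast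
      then have "a = abs_ordinal (s x)"
        using r' wo by (metis abs_ordinal_le_iff antisym ordIso_iff_ordLeq)
      then show "a \<in> (\<lambda>x. abs_ordinal (s x)) ` Field r"
        using \<open>x \<in> Field r\<close> by blast
    qed
  qed
  then show ?thesis using card_of_ordIso ordIso_symmetric by blast
qed

lemma Well_order_cardSuc_natLeq: "Well_order (cardSuc natLeq)"
  using natLeq_Card_order by (rule cardSuc_Well_order)

section \<open>Size and regularity of the first uncountable ordinal\<close>

lemma card_of_lessThan_omega1: "|{..<\<omega>\<^sub>1}| =o cardSuc natLeq"
  using card_of_lessThan_abs_ordinal[OF Well_order_cardSuc_natLeq]
    card_of_Field_ordIso[OF cardSuc_Card_order[OF natLeq_Card_order]]
  unfolding omega1.abs_eq by (rule ordIso_transitive)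

lemma uncountable_lessThan_omega1: "uncountable {..<\<omega>\<^sub>1}"
  using cardSuc_greater[OF natLeq_Card_order] card_of_lessThan_omega1
  unfolding countable_card_le_natLeq
  by (meson not_ordLess_ordLeq ordIso_ordLeq_trans ordIso_symmetric)

lemma countable_lessThan_ordinal:
  assumes "a < \<omega>\<^sub>1"
  shows "countable {..<a}"
proof -
  obtain r where r: "Well_order r" "a = abs_ordinal r" by (rule abs_ordinal_cases)
  then have "r <o cardSuc natLeq"
    using assms unfolding omega1.abs_eq by (simp add: abs_ordinal_less_iff Well_order_cardSuc_natLeq)
  moreover have "|Field r| \<le>o r" using r(1) by (simp add: card_of_least)
  ultimately have "|Field r| <o cardSuc natLeq" by (rule ordLeq_ordLess_trans[rotated])
  then have "|Field r| \<le>o natLeq"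
    using cardSuc_ordLeq_ordLess[OF natLeq_Card_order card_of_Card_order] by blast
  then show ?thesis
    using card_of_lessThan_abs_ordinal[OF r(1)] r(2)
    unfolding countable_card_le_natLeq by (metis ordIso_ordLeq_trans)
qed

lemma countable_atMost_ordinal: "a < \<omega>\<^sub>1 \<Longrightarrow> countable {..a}" for a :: ordinal
  using countable_lessThan_ordinal[of a] by (simp add: ivl_disj_un(2)[symmetric] lessThan_Suc)

text \<open>Each segment \<open>{..c}\<close> is countable, so countably many of them cannot exhaust
  the uncountable set \<open>{..<\<omega>\<^sub>1}\<close>; any ordinal that is missed is a strict
  bound. This turns countability into boundedness throughout.\<close>

lemma countable_ordinals_bounded:
  assumes "countable C" "C \<subseteq> {..<\<omega>\<^sub>1}"
  obtains a where "a < \<omega>\<^sub>1" "\<And>c. c \<in> C \<Longrightarrow> c < a"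
proof -
  have "countable (\<Union>c\<in>C. {..c})"
    using assms countable_atMost_ordinal by (intro countable_UN) auto
  then have "\<not> {..<\<omega>\<^sub>1} \<subseteq> (\<Union>c\<in>C. {..c})"
    using uncountable_lessThan_omega1 countable_subset by blast
  then show thesis using that by force
qed

lemma omega1_pos: "0 < \<omega>\<^sub>1"
  using countable_ordinals_bounded[of "{}"] zero_le_ordinal by (metis countable_empty empty_subsetI le_less_trans)

lemma not_less_zero_ordinal [simp]: "\<not> a < (0 :: ordinal)"
  using zero_le_ordinal by (simp add: not_less)

text \<open>A predecessor \<open>b\<close> would make \<open>{..<\<omega>\<^sub>1}\<close> a subset
  of the countable set \<open>{..b}\<close>. The fact makes the limit condition on retractions
  applicable at \<open>\<omega>\<^sub>1\<close> itself.\<close>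

lemma successor_ordinal_omega1: "\<not> successor_ordinal \<omega>\<^sub>1"
proof
  assume "successor_ordinal \<omega>\<^sub>1"
  then obtain b where "b < \<omega>\<^sub>1" "\<forall>c<\<omega>\<^sub>1. c \<le> b" by (auto simp: successor_ordinal_def)
  then have "{..<\<omega>\<^sub>1} \<subseteq> {..b}" by auto
  then show False
    using uncountable_lessThan_omega1 countable_atMost_ordinal[OF \<open>b < \<omega>\<^sub>1\<close>] countable_subset by blast
qed

lemma limit_ordinal_between:
  assumes "\<not> successor_ordinal a" "b < a"
  obtains c where "b < c" "c < a"
  using assms that unfolding successor_ordinal_def by (meson not_le)

lemma card_le_omega1_imp_inj:
  assumes "|I| \<le>o cardSuc natLeq"
  obtains h where "inj_on h I" "h ` I \<subseteq> {..<\<omega>\<^sub>1}"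
proof -
  have "|I| \<le>o |{..<\<omega>\<^sub>1}|"
    using assms card_of_lessThan_omega1 by (meson ordIso_symmetric ordLeq_ordIso_trans)
  then have "\<exists>h. inj_on h I \<and> h ` I \<subseteq> {..<\<omega>\<^sub>1}" by (simp only: card_of_ordLeq)
  then show thesis using that by blast
qed

lemma infinite_Field_cardSuc_natLeq: "infinite (Field (cardSuc natLeq))"
  using cardSuc_finite[OF natLeq_Card_order] Field_natLeq by simp

lemma card_UN_countable_le_omega1:
  assumes "|I| \<le>o cardSuc natLeq" "\<And>i. i \<in> I \<Longrightarrow> countable (A i)"
  shows "|\<Union>i\<in>I. A i| \<le>o cardSuc natLeq"
proof (rule card_of_UNION_ordLeq_infinite_Field)
  show "\<forall>i\<in>I. |A i| \<le>o cardSuc natLeq"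
    using assms(2) cardSuc_ordLeq[OF natLeq_Card_order]
    unfolding countable_card_le_natLeq by (meson ordLeq_transitive)
qed (use assms infinite_Field_cardSuc_natLeq cardSuc_Card_order[OF natLeq_Card_order] in auto)

section \<open>Separating families of real functions\<close>

text \<open>Finite intersection property in indexed form with a distinguished closed set
  \<open>F\<close>. Taking \<open>F\<close> to be the whole space constructs a point from finite
  approximations; taking \<open>F\<close> to be the complement of a neighbourhood refutes that no
  small neighbourhood exists.\<close>

lemma compact_space_common_point:
  assumes X: "compact_space X" and F: "closedin X F" and cl: "\<And>i. i \<in> I \<Longrightarrow> closedin X (C i)"
    and fin: "\<And>J. finite J \<Longrightarrow> J \<subseteq> I \<Longrightarrow> \<exists>x\<in>F. \<forall>i\<in>J. x \<in> C i"
  shows "\<exists>x\<in>F. \<forall>i\<in>I. x \<in> C i"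
proof -
  define \<U> where "\<U> = insert (F) (C ` I)"
  have "\<Inter>\<F> \<noteq> {}" if \<F>: "finite \<F>" "\<F> \<subseteq> \<U>" for \<F>
  proof -
    have "finite (\<F> - {F})" "\<F> - {F} \<subseteq> C ` I"
      using \<F> by (auto simp: \<U>_def)
    from finite_subset_image[OF this]
    obtain J where "finite J" "J \<subseteq> I" and J: "\<F> - {F} = C ` J" by blast
    from fin[OF this(1,2)] obtain x where x: "x \<in> F" "\<forall>i\<in>J. x \<in> C i" by blast
    have "x \<in> V" if "V \<in> \<F>" for V
      using that x J by (cases "V = F") auto
    then show ?thesis by blast
  qed
  moreover have "closedin X V" if "V \<in> \<U>" for V
    using that cl F by (auto simp: \<U>_def)
  ultimately have "(\<forall>C\<in>\<U>. closedin X C) \<and> (\<forall>\<F>. finite \<F> \<and> \<F> \<subseteq> \<U> \<longrightarrow> \<Inter>\<F> \<noteq> {})"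
    by simp
  then have "\<Inter>\<U> \<noteq> {}"
    by (rule compact_space_fip[THEN iffD1, OF X, THEN spec, THEN mp])
  then show ?thesis by (auto simp: \<U>_def)
qed

text \<open>A rational strictly between two different reals yields an interval around
  \<open>a\<close> whose closure misses \<open>b\<close>. Rational endpoints keep the number of
  intervals per coordinate countable.\<close>

lemma real_eqI_rational_intervals:
  fixes a b :: real
  assumes "\<And>p q. p \<in> \<rat> \<Longrightarrow> q \<in> \<rat> \<Longrightarrow> p < a \<Longrightarrow> a < q \<Longrightarrow> p \<le> b \<and> b \<le> q"
  shows "a = b"
proof (rule ccontr)
  assume "a \<noteq> b"
  obtain p q where pq: "p \<in> \<rat>" "p < a" "q \<in> \<rat>" "a < q"
    using Rats_dense_in_real[of "a - 1" a] Rats_dense_in_real[of a "a + 1"] by auto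
  consider "a < b" | "b < a" using \<open>a \<noteq> b\<close> by linarith
  then show False
  proof cases
    case 1
    then obtain t where "t \<in> \<rat>" "a < t" "t < b" using Rats_dense_in_real by blast
    then show False using assms[of p t] pq by auto
  next
    case 2
    then obtain t where "t \<in> \<rat>" "b < t" "t < a" using Rats_dense_in_real by blast
    then show False using assms[of t q] pq by auto
  qed
qed

section \<open>The weak topology of a separating family on a compact space\<close>

definition coord_box :: "'a topology \<Rightarrow> ('i \<Rightarrow> 'a \<Rightarrow> real) \<Rightarrow> ('i \<times> real \<times> real) set \<Rightarrow> 'a set" where
  "coord_box X f J = {x \<in> topspace X. \<forall>(i, p, q)\<in>J. p < f i x \<and> f i x < q}"

lemma openin_coord_box:
  assumes "finite J" "\<And>i. i \<in> fst ` J \<Longrightarrow> continuous_map X euclideanreal (f i)"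
  shows "openin X (coord_box X f J)"
  using assms
proof (induction J)
  case empty
  then show ?case by (simp add: coord_box_def)
next
  case (insert j J)
  obtain i p q where j: "j = (i, p, q)" by (metis prod.exhaust)
  have "continuous_map X euclideanreal (f i)" using insert.prems j by force
  then have "openin X {x \<in> topspace X. f i x \<in> {p<..<q}}"
    by (rule openin_continuous_map_preimage) auto
  moreover have "coord_box X f (insert j J) = {x \<in> topspace X. f i x \<in> {p<..<q}} \<inter> coord_box X f J"
    by (auto simp: coord_box_def j)
  ultimately show ?case using insert by auto
qed

lemma closedin_coord_slab:
  assumes "continuous_map X euclideanreal f"
  shows "closedin X {x \<in> topspace X. p \<le> f x \<and> f x \<le> q}"
  using closedin_continuous_map_preimage[OF assms, of "{p..q}"] by auto

locale separating_family =
  fixes X :: "'a topology" and I :: "'i set" and f :: "'i \<Rightarrow> 'a \<Rightarrow> real"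
  assumes compact: "compact_space X"
    and cont: "i \<in> I \<Longrightarrow> continuous_map X euclideanreal (f i)"
    and separating: "x \<in> topspace X \<Longrightarrow> y \<in> topspace X \<Longrightarrow> (\<And>i. i \<in> I \<Longrightarrow> f i x = f i y) \<Longrightarrow> x = y"
begin

text \<open>A compact topology is the weak topology of its separating family. If every box around
  \<open>x\<close> left \<open>U\<close>, the closed rational slabs around the values
  \<open>f i x\<close> would have a common point outside \<open>U\<close> by compactness; this point
  agrees with \<open>x\<close> in all coordinates, so it is \<open>x\<close>.\<close>

lemma coord_box_base:
  assumes U: "openin X U" "x \<in> U"
  shows "\<exists>J. finite J \<and> J \<subseteq> I \<times> \<rat> \<times> \<rat> \<and> x \<in> coord_box X f J \<and> coord_box X f J \<subseteq> U"
proof (rule ccontr)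
  assume no: "\<not> ?thesis"
  have x: "x \<in> topspace X" using U openin_subset by blast
  define D where "D = {(i, p, q). i \<in> I \<and> p \<in> \<rat> \<and> q \<in> \<rat> \<and> p < f i x \<and> f i x < q}"
  define C where "C = (\<lambda>(i, p, q). {y \<in> topspace X. p \<le> f i y \<and> f i y \<le> q})"
  have "\<exists>y\<in>topspace X - U. \<forall>j\<in>D. y \<in> C j"
  proof (rule compact_space_common_point[OF compact closedin_diff[OF closedin_topspace U(1)]])
    show "closedin X (C j)" if "j \<in> D" for j
      using that cont by (auto simp: D_def C_def intro!: closedin_coord_slab)
    fix J assume J: "finite J" "J \<subseteq> D"
    moreover have "J \<subseteq> I \<times> \<rat> \<times> \<rat>" using J by (auto simp: D_def)
    moreover have "x \<in> coord_box X f J" using J x by (auto simp: D_def coord_box_def)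
    ultimately have "\<not> coord_box X f J \<subseteq> U" using no by auto
    then obtain y where y: "y \<in> coord_box X f J" "y \<notin> U" by blast
    have "y \<in> C j" if "j \<in> J" for j
      using that y(1) by (auto simp: C_def coord_box_def less_imp_le split: prod.split)
    moreover have "y \<in> topspace X - U" using y by (simp add: coord_box_def)
    ultimately show "\<exists>y\<in>topspace X - U. \<forall>j\<in>J. y \<in> C j" by blast
  qed
  then obtain y where y: "y \<in> topspace X - U" "\<And>j. j \<in> D \<Longrightarrow> y \<in> C j" by blast
  have "f i x = f i y" if "i \<in> I" for i
  proof (rule real_eqI_rational_intervals)
    fix p q :: real assume "p \<in> \<rat>" "q \<in> \<rat>" "p < f i x" "f i x < q"
    then have "(i, p, q) \<in> D" using that by (auto simp: D_def)
    then show "p \<le> f i y \<and> f i y \<le> q" using y(2)[of "(i, p, q)"] by (auto simp: C_def)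
  qed
  then have "x = y" using separating x y(1) by blast
  then show False using y(1) U by simp
qed

text \<open>Boxes form a base, and the preimage of a box under \<open>h\<close> is a box for the
  composed functions; hence continuity can be checked coordinatewise.\<close>

lemma continuous_map_into:
  assumes h: "h ` topspace Y \<subseteq> topspace X"
    and fh: "\<And>i. i \<in> I \<Longrightarrow> continuous_map Y euclideanreal (\<lambda>y. f i (h y))"
  shows "continuous_map Y X h"
  unfolding continuous_map_def
proof (intro conjI allI impI)
  show "h \<in> topspace Y \<rightarrow> topspace X" using h by auto
  fix U assume U: "openin X U"
  show "openin Y {y \<in> topspace Y. h y \<in> U}"
  proof (subst openin_subopen, intro ballI)
    fix y assume "y \<in> {y \<in> topspace Y. h y \<in> U}"
    then have y: "y \<in> topspace Y" "h y \<in> U" by auto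
    obtain J where J: "finite J" "J \<subseteq> I \<times> \<rat> \<times> \<rat>" "h y \<in> coord_box X f J" "coord_box X f J \<subseteq> U"
      using coord_box_base[OF U y(2)] by auto
    have "openin Y (coord_box Y (\<lambda>i y. f i (h y)) J)"
      using J(1,2) fh by (intro openin_coord_box) auto
    moreover have "y \<in> coord_box Y (\<lambda>i y. f i (h y)) J"
      using J(3) y by (auto simp: coord_box_def)
    moreover have "coord_box Y (\<lambda>i y. f i (h y)) J \<subseteq> {y \<in> topspace Y. h y \<in> U}"
    proof
      fix z assume z: "z \<in> coord_box Y (\<lambda>i y. f i (h y)) J"
      then have "h z \<in> coord_box X f J" using h by (auto simp: coord_box_def)
      then show "z \<in> {y \<in> topspace Y. h y \<in> U}" using J(4) z by (auto simp: coord_box_def)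
    qed
    ultimately show "\<exists>T. openin Y T \<and> y \<in> T \<and> T \<subseteq> {y \<in> topspace Y. h y \<in> U}" by blast
  qed
qed

lemma continuous_map_coordinates: "continuous_map X (powertop_real I) (\<lambda>x. restrict (\<lambda>i. f i x) I)"
  using cont by (auto simp: continuous_map_componentwise)

lemma inj_on_coordinates: "inj_on (\<lambda>x. restrict (\<lambda>i. f i x) I) (topspace X)"
proof (rule inj_onI)
  fix x y assume xy: "x \<in> topspace X" "y \<in> topspace X" "restrict (\<lambda>i. f i x) I = restrict (\<lambda>i. f i y) I"
  have "f i x = f i y" if "i \<in> I" for i using fun_cong[OF xy(3), of i] that by simp
  then show "x = y" using separating xy by blast
qed

text \<open>The finite sets of constraints are counted in stages: with \<open>I\<close> injected
  into \<open>\<omega>\<^sub>1\<close>, every finite \<open>J\<close> lies in some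
  \<open>N a\<close> with \<open>a < \<omega>\<^sub>1\<close>, and each \<open>N a\<close> is
  countable and so has only countably many finite subsets.\<close>

lemma weight_le_omega1:
  assumes "|I| \<le>o cardSuc natLeq"
  shows "weight X \<le>o cardSuc natLeq"
proof -
  obtain h where h: "inj_on h I" "h ` I \<subseteq> {..<\<omega>\<^sub>1}"
    using card_le_omega1_imp_inj[OF assms] by blast
  define N where "N = (\<lambda>a. {i \<in> I. h i < (a :: ordinal)} \<times> (\<rat> :: real set) \<times> (\<rat> :: real set))"
  define B where "B = (\<Union>a\<in>{..<\<omega>\<^sub>1}. coord_box X f ` {J. finite J \<and> J \<subseteq> N a})"
  have cN: "countable (N a)" if "a < \<omega>\<^sub>1" for a
  proof -
    have "countable {i \<in> I. h i < a}"
    proof (rule countable_image_inj_on)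
      show "countable (h ` {i \<in> I. h i < a})"
        by (rule countable_subset[OF _ countable_lessThan_ordinal[OF that]]) auto
      show "inj_on h {i \<in> I. h i < a}" using h(1) by (rule inj_on_subset) auto
    qed
    then show ?thesis unfolding N_def by (intro countable_SIGMA countable_rat)
  qed
  have "|B| \<le>o cardSuc natLeq"
    unfolding B_def
  proof (rule card_UN_countable_le_omega1)
    show "|{..<\<omega>\<^sub>1}| \<le>o cardSuc natLeq" using card_of_lessThan_omega1 ordIso_iff_ordLeq by blast
    show "countable (coord_box X f ` {J. finite J \<and> J \<subseteq> N a})" if "a \<in> {..<\<omega>\<^sub>1}" for a
      using that cN by (intro countable_image countable_Collect_finite_subset) auto
  qed
  moreover have "topology_base X B"
    unfolding topology_base_def
  proof (intro conjI ballI allI impI)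
    fix V assume "V \<in> B"
    then obtain a J where "finite J" "J \<subseteq> N a" "V = coord_box X f J" by (auto simp: B_def)
    then show "openin X V" using cont by (auto intro!: openin_coord_box simp: N_def)
  next
    fix U x assume "openin X U \<and> x \<in> U"
    then obtain J where J: "finite J" "J \<subseteq> I \<times> \<rat> \<times> \<rat>" "x \<in> coord_box X f J" "coord_box X f J \<subseteq> U"
      using coord_box_base[of U x] by auto
    have "countable (h ` fst ` J)" "h ` fst ` J \<subseteq> {..<\<omega>\<^sub>1}"
      using J(1,2) h(2) by (auto intro!: countable_finite) blast
    then obtain a where a: "a < \<omega>\<^sub>1" "\<And>c. c \<in> h ` fst ` J \<Longrightarrow> c < a"
      using countable_ordinals_bounded by blast
    have "J \<subseteq> N a" using J(2) a(2) by (force simp: N_def)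
    then have "coord_box X f J \<in> B" using a(1) J(1) by (auto simp: B_def)
    then show "\<exists>V\<in>B. x \<in> V \<and> V \<subseteq> U" using J by blast
  qed
  ultimately show ?thesis unfolding weight_le_iff by blast
qed

end

section \<open>Countable separating families and metrizability\<close>

lemma separating_family_metrizable:
  assumes "separating_family X I f" "countable I"
  shows "metrizable_space X"
proof -
  interpret separating_family X I f by fact
  have "embedding_map X (powertop_real I) (\<lambda>x. restrict (\<lambda>i. f i x) I)"
    using continuous_map_coordinates compact inj_on_coordinates
    by (intro continuous_imp_embedding_map) (auto simp: Hausdorff_space_product_topology)
  then have "X homeomorphic_space subtopology (powertop_real I) ((\<lambda>x. restrict (\<lambda>i. f i x) I) ` topspace X)"
    by (rule embedding_map_imp_homeomorphic_space)
  moreover have "metrizable_space (powertop_real I)"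
    using assms(2) by (auto simp: metrizable_space_product_topology metrizable_space_euclidean intro: countable_subset)
  ultimately show ?thesis
    using homeomorphic_metrizable_space metrizable_space_subtopology by blast
qed

text \<open>The functions are the distances to the points of a countable dense set \<open>C\<close>
  obtained from total boundedness. A point of \<open>C\<close> closer to \<open>x\<close> than half
  of \<open>d x y\<close> cannot be equally far from \<open>x\<close> and \<open>y\<close>.\<close>

lemma compact_metrizable_separating:
  assumes "compact_space X" "metrizable_space X"
  obtains f where "separating_family X (UNIV :: nat set) f"
proof -
  obtain M d where "Metric_space M d" and X: "X = Metric_space.mtopology M d"
    using assms(2) by (auto simp: metrizable_space_def)
  then interpret Metric_space M d by simp
  have "mtotally_bounded M"
    using assms(1) by (simp add: X compact_space_eq_mcomplete_mtotally_bounded)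
  then have "\<exists>K. finite K \<and> K \<subseteq> M \<and> M \<subseteq> (\<Union>x\<in>K. mball x (inverse (Suc n)))" for n :: nat
    unfolding mtotally_bounded_def by (metis inverse_positive_iff_positive of_nat_0_less_iff zero_less_Suc)
  then obtain K where K: "\<And>n :: nat. finite (K n) \<and> K n \<subseteq> M \<and> M \<subseteq> (\<Union>x\<in>K n. mball x (inverse (Suc n)))"
    by metis
  define C where "C = (\<Union>n. K n)"
  have C: "countable C" "C \<subseteq> M"
    unfolding C_def using K by (auto intro: countable_finite)
  have CM: "C \<noteq> {}" if "M \<noteq> {}"
    using that K[of 0] by (auto simp: C_def)
  define f where "f = (\<lambda>n. d (from_nat_into C n))"
  have "separating_family X (UNIV :: nat set) f"
  proof
    show "compact_space X" by fact
    show "continuous_map X euclideanreal (f n)" for n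
    \<comment> \<open>On the empty space \<open>C\<close> is empty and
      \<open>from_nat_into C n\<close> is an arbitrary element, which need not lie in
      \<open>M\<close>.\<close>
    proof (cases "M = {}")
      case True
      then have "X = trivial_topology"
        using null_topspace_iff_trivial[of X] topspace_mtopology X by metis
      then show ?thesis by simp
    next
      case False
      then have "from_nat_into C n \<in> M" using from_nat_into[OF CM] C(2) by auto
      then show ?thesis
        using continuous_on_mdist[of "from_nat_into C n" "metric (M, d)"]
        by (simp add: X f_def mtopology_of_def)
    qed
  next
    fix x y assume xy: "x \<in> topspace X" "y \<in> topspace X" and eq: "\<And>n. n \<in> UNIV \<Longrightarrow> f n x = f n y"
    show "x = y"
    proof (rule ccontr)
      assume "x \<noteq> y"
      then have pos: "0 < d x y / 2" using xy by (simp add: X)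
      then obtain n where n: "inverse (real (Suc n)) < d x y / 2" using reals_Archimedean by blast
      obtain c where c: "c \<in> K n" "x \<in> mball c (inverse (Suc n))"
        using K[of n] xy by (auto simp: X)
      then have "c \<in> C" by (auto simp: C_def)
      then obtain m where "from_nat_into C m = c" using C(1) from_nat_into_surj by metis
      then have "d c x = d c y" using eq[of m] by (simp add: f_def)
      moreover have "d c x < d x y / 2" "c \<in> M" using c n by auto
      ultimately show False
        using triangle[of x c y] xy commute[of x c] by (auto simp: X)
    qed
  qed
  then show thesis by (rule that)
qed

lemma (in separating_family) Sigma_subset_countable_support:
  "Sigma_subset X {x \<in> topspace X. countable {i \<in> I. f i x \<noteq> 0}}"
proof (rule Sigma_subsetI)
  define \<phi> where "\<phi> = (\<lambda>x. restrict (\<lambda>i. f i x) I)"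
  have "continuous_map X (powertop_real I) \<phi>" "inj_on \<phi> (topspace X)"
    unfolding \<phi>_def by (fact continuous_map_coordinates inj_on_coordinates)+
  moreover have "{i \<in> I. \<phi> x i \<noteq> 0} = {i \<in> I. f i x \<noteq> 0}" for x
    by (auto simp: \<phi>_def)
  then have "{x \<in> topspace X. countable {i \<in> I. f i x \<noteq> 0}} = {x \<in> topspace X. \<phi> x \<in> Sigma_product I}"
    by (auto simp: Sigma_product_def \<phi>_def)
  ultimately show "Sigma_subset_via I X {x \<in> topspace X. countable {i \<in> I. f i x \<noteq> 0}}"
    unfolding Sigma_subset_via_def by blast
qed

section \<open>Trees from sequences of retractions\<close>

lemma paths_level_iff:
  assumes "graded_tree T r \<delta>"
  shows "A \<in> paths (level T \<delta> a) r \<longleftrightarrow> A \<in> paths T r \<and> (\<forall>t\<in>A. \<delta> t \<le> a)"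
proof -
  have "A \<subseteq> T" if "A \<in> paths T r"
    using that by (auto simp: paths_def path_in_def initial_part_def)
  then show ?thesis
    unfolding paths_initial_part[OF initial_part_level[OF assms]] by (auto simp: level_def)
qed

lemma path_subset: "A \<in> paths T r \<Longrightarrow> A \<subseteq> T"
  by (auto simp: paths_def path_in_def initial_part_def)

lemma path_total:
  assumes "A \<in> paths T r" "s \<in> A" "t \<in> A" "s \<noteq> t"
  shows "s \<in> underS r t \<or> t \<in> underS r s"
  using assms by (auto simp: paths_def path_in_def total_on_def underS_def)

lemma path_downward_closed:
  assumes "A \<in> paths T r" "t \<in> A" "s \<in> T" "s \<in> underS r t"
  shows "s \<in> A"
  using assms by (auto simp: paths_def path_in_def initial_part_def)

lemma graded_tree_underS_less:
  "graded_tree T r \<delta> \<Longrightarrow> t \<in> T \<Longrightarrow> s \<in> underS r t \<Longrightarrow> \<delta> s < \<delta> t"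
  by (auto simp: graded_tree_def)

text \<open>Distinct nodes of a path are comparable and the grade increases strictly along the
  order. Cardinality questions about a path thus become questions about its set of grades.\<close>

lemma grade_inj_on_path:
  assumes "graded_tree T r \<delta>" "A \<in> paths T r"
  shows "inj_on \<delta> A"
proof (rule inj_onI, rule ccontr)
  fix s t assume st: "s \<in> A" "t \<in> A" "\<delta> s = \<delta> t" "s \<noteq> t"
  then have "\<delta> s < \<delta> t \<or> \<delta> t < \<delta> s"
    using path_total[OF assms(2)] graded_tree_underS_less[OF assms(1)] path_subset[OF assms(2)] by blast
  then show False using st by simp
qed

text \<open>By injectivity of the grade a path is countable iff its set of grades is, and a set of
  ordinals below \<open>\<omega>\<^sub>1\<close> is countable iff it is bounded below
  \<open>\<omega>\<^sub>1\<close>.\<close>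

lemma UN_paths_level_eq_countable_paths:
  assumes "graded_tree_below \<omega>\<^sub>1 T r \<delta>"
  shows "(\<Union>a\<in>{..<\<omega>\<^sub>1}. paths (level T \<delta> a) r) = {A \<in> paths T r. countable A}"
proof -
  have gt: "graded_tree T r \<delta>" and below: "\<And>t. t \<in> T \<Longrightarrow> \<delta> t < \<omega>\<^sub>1"
    using assms by (auto simp: graded_tree_below_def)
  show ?thesis
  proof (intro equalityI subsetI)
    fix A assume "A \<in> (\<Union>a\<in>{..<\<omega>\<^sub>1}. paths (level T \<delta> a) r)"
    then obtain a where a: "a < \<omega>\<^sub>1" "A \<in> paths T r" "\<forall>t\<in>A. \<delta> t \<le> a"
      by (auto simp: paths_level_iff[OF gt])
    then have "countable (\<delta> ` A)"
      by (intro countable_subset[OF _ countable_atMost_ordinal[of a]]) auto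
    then have "countable A"
      using grade_inj_on_path[OF gt a(2)] by (rule countable_image_inj_on)
    then show "A \<in> {A \<in> paths T r. countable A}" using a by simp
  next
    fix A assume "A \<in> {A \<in> paths T r. countable A}"
    then have A: "A \<in> paths T r" "countable A" by auto
    then have "countable (\<delta> ` A)" "\<delta> ` A \<subseteq> {..<\<omega>\<^sub>1}"
      using path_subset[OF A(1)] below by auto
    then obtain a where a: "a < \<omega>\<^sub>1" "\<And>c. c \<in> \<delta> ` A \<Longrightarrow> c < a"
      using countable_ordinals_bounded by metis
    then have "A \<in> paths (level T \<delta> a) r"
      using A(1) by (auto simp: paths_level_iff[OF gt] less_imp_le)
    then show "A \<in> (\<Union>a\<in>{..<\<omega>\<^sub>1}. paths (level T \<delta> a) r)" using a(1) by auto
  qed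
qed

text \<open>Transport of structure: pulling the topology back along the inverse of a bijection turns
  the bijection into a homeomorphism. The path set of the constructed tree gets its topology this
  way.\<close>

lemma homeomorphic_maps_pullback_inv:
  assumes g: "bij_betw g (topspace K) P"
  defines "h \<equiv> inv_into (topspace K) g"
  shows "homeomorphic_maps K (pullback_topology P h K) g h" "topspace (pullback_topology P h K) = P"
proof -
  have h: "h A \<in> topspace K" "g (h A) = A" if "A \<in> P" for A
    using that g unfolding h_def
    by (auto simp: bij_betw_def inv_into_into f_inv_into_f)
  have hg: "h (g x) = x" "g x \<in> P" if "x \<in> topspace K" for x
    using that g unfolding h_def by (auto simp: bij_betw_def)
  show top: "topspace (pullback_topology P h K) = P"
    using h by (auto simp: topspace_pullback_topology)
  have "continuous_map K K (h \<circ> g)"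
    by (rule continuous_map_eq[OF continuous_map_id]) (simp add: hg)
  then have "continuous_map K (pullback_topology P h K) g"
    using hg by (intro continuous_map_pullback') auto
  moreover have "continuous_map (pullback_topology P h K) K h"
    using continuous_map_pullback[OF continuous_map_id, of P h K] by simp
  ultimately show "homeomorphic_maps K (pullback_topology P h K) g h"
    unfolding homeomorphic_maps_def top using h hg by simp
qed

text \<open>Continuity of the chain at limits is stated as \<open>r_limit\<close>: at a limit stage
  a retract is determined by the earlier ones. At \<open>\<omega>\<^sub>1\<close>, together with
  \<open>r_omega1\<close>, this says that the retracts \<open>r a x\<close> with
  \<open>a < \<omega>\<^sub>1\<close> determine \<open>x\<close>.\<close>

locale retraction_sequence =
  fixes K :: "'a topology" and r :: "ordinal \<Rightarrow> 'a \<Rightarrow> 'a"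
  assumes compact: "compact_space K" and Hausdorff: "Hausdorff_space K"
    and continuous_r: "continuous_map K K (r a)"
    and r_r: "x \<in> topspace K \<Longrightarrow> r a (r b x) = r (min a b) x"
    and r_limit: "x \<in> topspace K \<Longrightarrow> y \<in> topspace K \<Longrightarrow> a \<noteq> 0 \<Longrightarrow> \<not> successor_ordinal a \<Longrightarrow>
      (\<And>b. b < a \<Longrightarrow> r b x = r b y) \<Longrightarrow> r a x = r a y"
    and r_omega1: "x \<in> topspace K \<Longrightarrow> r \<omega>\<^sub>1 x = x"
begin

text \<open>A point fixed by some \<open>r a\<close> with \<open>a < \<omega>\<^sub>1\<close> whose grade is a limit is not a node: it corresponds
  to a path without a last element.\<close>

definition \<delta> :: "'a \<Rightarrow> ordinal" where
  "\<delta> x = (LEAST a. r a x = x)"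

definition T :: "'a set" where
  "T = {x \<in> topspace K. \<delta> x < \<omega>\<^sub>1 \<and> (successor_ordinal (\<delta> x) \<or> \<delta> x = 0)}"

definition tle :: "'a rel" where
  "tle = {(s, t). s \<in> T \<and> t \<in> T \<and> r (\<delta> s) t = s}"

definition branch :: "'a \<Rightarrow> 'a set" where
  "branch x = {t \<in> T. r (\<delta> t) x = t}"

section \<open>Grades of points and the order on nodes\<close>

lemma r_in_topspace: "x \<in> topspace K \<Longrightarrow> r a x \<in> topspace K"
  using continuous_map_image_subset_topspace[OF continuous_r] by blast

text \<open>The stages fixing \<open>x\<close> contain \<open>\<omega>\<^sub>1\<close>, so a least
  one exists, and \<open>r_r\<close> makes them upward closed.\<close>

lemma r_fixed_iff:
  assumes "x \<in> topspace K"
  shows "r a x = x \<longleftrightarrow> \<delta> x \<le> a"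
proof
  show "r a x = x \<Longrightarrow> \<delta> x \<le> a" unfolding \<delta>_def by (rule Least_le)
  assume "\<delta> x \<le> a"
  moreover have "r (\<delta> x) x = x" unfolding \<delta>_def by (rule LeastI[of _ "\<omega>\<^sub>1"]) (rule r_omega1[OF assms])
  ultimately show "r a x = x" using r_r[OF assms, of a "\<delta> x"] by (simp add: min_absorb2)
qed

lemma \<delta>_r_le: "x \<in> topspace K \<Longrightarrow> \<delta> (r a x) \<le> a"
  using r_fixed_iff[OF r_in_topspace[of x a], of a] r_r[of x a a] by simp

lemma T_topspace: "t \<in> T \<Longrightarrow> t \<in> topspace K"
  by (simp add: T_def)

lemma \<delta>_mono_r:
  assumes "x \<in> topspace K"
  shows "\<delta> (r a x) \<le> \<delta> x"
proof -
  have "r (\<delta> x) (r a x) = r a (r (\<delta> x) x)" using assms by (simp add: r_r min.commute)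
  also have "\<dots> = r a x" using assms r_fixed_iff[of x "\<delta> x"] by simp
  finally show ?thesis using assms r_fixed_iff[OF r_in_topspace] by blast
qed

lemma tle_\<delta>: "(s, t) \<in> tle \<Longrightarrow> \<delta> s \<le> \<delta> t"
  using \<delta>_mono_r[of t "\<delta> s"] by (auto simp: tle_def T_topspace)

lemma tle_trans_r: "s \<in> T \<Longrightarrow> t \<in> T \<Longrightarrow> \<delta> s \<le> \<delta> t \<Longrightarrow> x \<in> topspace K \<Longrightarrow>
    r (\<delta> s) x = s \<Longrightarrow> r (\<delta> t) x = t \<Longrightarrow> (s, t) \<in> tle"
  using r_r[of x "\<delta> s" "\<delta> t"] by (simp add: tle_def min_absorb1)

lemma tle_\<delta>_less: "(s, t) \<in> tle \<Longrightarrow> s \<noteq> t \<Longrightarrow> \<delta> s < \<delta> t"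
  using tle_\<delta>[of s t] r_fixed_iff[of t "\<delta> s"] by (auto simp: tle_def T_topspace order_less_le)

lemma r_zero_in_T: "x \<in> topspace K \<Longrightarrow> r 0 x \<in> T \<and> \<delta> (r 0 x) = 0"
  using \<delta>_r_le[of x 0] zero_le_ordinal[of "\<delta> (r 0 x)"] omega1_pos
  by (simp add: T_def r_in_topspace order_antisym)

lemma tle_partial_order: "partial_order_on T tle"
proof -
  have "refl_on T tle"
    by (auto simp: refl_on_def tle_def r_fixed_iff T_topspace)
  moreover have "trans tle"
  proof (rule transI)
    fix s t u assume st: "(s, t) \<in> tle" and tu: "(t, u) \<in> tle"
    have u: "u \<in> topspace K" using tu by (auto simp: tle_def T_topspace)
    have "s = r (\<delta> s) (r (\<delta> t) u)" using st tu by (simp add: tle_def)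
    also have "\<dots> = r (\<delta> s) u"
      using tle_\<delta>[OF st] u by (simp add: r_r min_absorb1)
    finally show "(s, u) \<in> tle" using st tu by (simp add: tle_def)
  qed
  moreover have "antisym tle"
    by (rule antisymI) (metis tle_\<delta>_less less_asym)
  moreover have "tle \<subseteq> T \<times> T" by (auto simp: tle_def)
  ultimately show ?thesis by (simp add: partial_order_on_def preorder_on_def)
qed

text \<open>Any two nodes below \<open>t\<close> are retracts of the same point \<open>t\<close>,
  hence comparable by their grades. Well-foundedness is pulled back from the ordinals along
  \<open>\<delta>\<close>.\<close>

lemma tle_tree: "tree T tle"
  unfolding tree_def
proof (intro conjI ballI tle_partial_order)
  fix t assume t: "t \<in> T"
  let ?A = "underS tle t"
  have tr: "trans tle" and an: "antisym tle" and re: "refl_on T tle"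
    using tle_partial_order by (auto simp: partial_order_on_def preorder_on_def)
  have sub: "?A \<subseteq> T" by (auto simp: underS_def tle_def)
  have "partial_order_on ?A (Restr tle ?A)"
    unfolding partial_order_on_def preorder_on_def
    using re sub tr an by (auto simp: refl_on_def intro!: trans_Restr antisym_Restr)
  moreover have "total_on ?A (Restr tle ?A)"
  proof (rule total_onI)
    fix s u assume su: "s \<in> ?A" "u \<in> ?A" "s \<noteq> u"
    then have "(s, t) \<in> tle" "(u, t) \<in> tle" by (auto simp: underS_def)
    then have "(s, u) \<in> tle \<or> (u, s) \<in> tle"
      using tle_trans_r[of s u t] tle_trans_r[of u s t] le_cases[of "\<delta> s" "\<delta> u"]
      by (auto simp: tle_def T_topspace)
    then show "(s, u) \<in> Restr tle ?A \<or> (u, s) \<in> Restr tle ?A" using su by auto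
  qed
  moreover have "wf (Restr tle ?A - Id)"
  proof (rule wf_subset)
    show "wf (inv_image {(a :: ordinal, b). a < b} \<delta>)" by (intro wf_inv_image wf)
    show "Restr tle ?A - Id \<subseteq> inv_image {(a, b). a < b} \<delta>"
      using tle_\<delta>_less by (auto simp: inv_image_def)
  qed
  ultimately show "well_order_on ?A (Restr tle ?A)"
    by (simp add: well_order_on_def linear_order_on_def)
qed

text \<open>For the condition on minimal nodes: \<open>r 0 t\<close> is always a node of grade zero
  below \<open>t\<close>, so a minimal \<open>t\<close> coincides with it.\<close>

lemma tle_graded: "graded_tree_below \<omega>\<^sub>1 T tle \<delta>"
  unfolding graded_tree_below_def graded_tree_def
proof (intro conjI ballI tle_tree impI)
  fix t assume t: "t \<in> T"
  show "successor_ordinal (\<delta> t) \<or> \<delta> t = 0" "\<delta> t < \<omega>\<^sub>1" using t by (auto simp: T_def)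
  show "\<delta> s < \<delta> t" if "s \<in> underS tle t" for s
    using that tle_\<delta>_less by (auto simp: underS_def)
  show "\<delta> t = 0" if "underS tle t = {}"
  proof (rule ccontr)
    assume "\<delta> t \<noteq> 0"
    moreover note r0 = r_zero_in_T[OF T_topspace[OF t]]
    ultimately have "r 0 t \<noteq> t" by metis
    moreover have "(r 0 t, t) \<in> tle" using r0 t by (simp add: tle_def)
    ultimately show False using that by (auto simp: underS_def)
  qed
qed

text \<open>If \<open>t\<close> is a retract of \<open>r a x\<close>, then \<open>t\<close> equals
  \<open>r (min (\<delta> t) a) x\<close>, whose grade is at most that minimum; so
  \<open>\<delta> t \<le> a\<close>. Thus \<open>r a\<close> acts on branches as the restriction to
  level \<open>a\<close>, which is the map in the compatibility condition.\<close>

lemma branch_r: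
  assumes "x \<in> topspace K"
  shows "branch (r a x) = {t \<in> branch x. \<delta> t \<le> a}"
proof -
  have "r (\<delta> t) (r a x) = t \<longleftrightarrow> r (\<delta> t) x = t \<and> \<delta> t \<le> a" if t: "t \<in> T" for t
  proof
    assume *: "r (\<delta> t) (r a x) = t"
    then have eq: "t = r (min (\<delta> t) a) x" using r_r[OF assms] by metis
    then have "\<delta> t \<le> min (\<delta> t) a" using \<delta>_r_le[OF assms] by metis
    then show "r (\<delta> t) x = t \<and> \<delta> t \<le> a" using eq by (simp add: min_def split: if_splits)
  qed (simp add: r_r assms min_absorb1)
  then show ?thesis by (auto simp: branch_def)
qed

lemma branch_in_paths:
  assumes x: "x \<in> topspace K"
  shows "branch x \<in> paths T tle"
proof -
  have down: "s \<in> branch x" if "t \<in> branch x" "s \<in> underS tle t" for s t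
  proof -
    have st: "(s, t) \<in> tle" using that(2) by (simp add: underS_def)
    then have "s = r (\<delta> s) (r (\<delta> t) x)" using that(1) by (simp add: tle_def branch_def)
    also have "\<dots> = r (\<delta> s) x" using tle_\<delta>[OF st] x by (simp add: r_r min_absorb1)
    finally show ?thesis using st by (simp add: branch_def tle_def)
  qed
  have "r 0 x \<in> branch x"
    using r_zero_in_T[OF x] by (simp add: branch_def)
  moreover have "total_on (branch x) tle"
  proof (rule total_onI)
    fix s t assume "s \<in> branch x" "t \<in> branch x" "s \<noteq> t"
    then show "(s, t) \<in> tle \<or> (t, s) \<in> tle"
      using tle_trans_r[of s t x] tle_trans_r[of t s x] le_cases[of "\<delta> s" "\<delta> t"] x
      by (auto simp: branch_def)
  qed
  moreover have "initial_part T tle (branch x)"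
    unfolding initial_part_def
  proof (intro conjI ballI subsetI)
    show "t \<in> T" if "t \<in> branch x" for t using that by (simp add: branch_def)
    show "s \<in> branch x" if "t \<in> branch x" "s \<in> T \<inter> underS tle t" for s t
      using that down by simp
  qed
  ultimately show ?thesis by (force simp: paths_def path_in_def)
qed

text \<open>Induction shows \<open>r a x = r a y\<close> for all
  \<open>a < \<omega>\<^sub>1\<close>. At zero or a successor, either one of the two retracts is a
  node of grade \<open>a\<close> and lies on the common branch, or both retracts already occur at an
  earlier stage. Limits, and finally \<open>\<omega>\<^sub>1\<close>, are handled by
  \<open>r_limit\<close>.\<close>

lemma branch_inj: "inj_on branch (topspace K)"
proof (rule inj_onI)
  fix x y assume x: "x \<in> topspace K" and y: "y \<in> topspace K" and eq: "branch x = branch y"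
  \<comment> \<open>Stated for bound variables \<open>x\<close> and \<open>y\<close>, because it is
    applied below with the two points in either order.\<close>
  have transfer: "r a y = r a x"
    if "a < \<omega>\<^sub>1" "successor_ordinal a \<or> a = 0" "\<delta> (r a x) = a" "x \<in> topspace K" "branch x = branch y"
    for a x y
  proof -
    have "r a x \<in> branch x"
      using that(1-4) r_in_topspace[of x a] by (simp add: branch_def T_def)
    then have "r a x \<in> branch y" using that(5) by simp
    then show ?thesis using that(3) by (simp add: branch_def)
  qed
  have "a < \<omega>\<^sub>1 \<longrightarrow> r a x = r a y" for a
  proof (induction a rule: less_induct)
    case (less a)
    show ?case
    proof
      assume a: "a < \<omega>\<^sub>1"
      then have IH: "r b x = r b y" if "b < a" for b using less that by (meson less_trans)
      show "r a x = r a y"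
      proof (cases "successor_ordinal a \<or> a = 0")
        case True
        show ?thesis
        proof (cases "\<delta> (r a x) = a \<or> \<delta> (r a y) = a")
          case True': True
          then show ?thesis
            using transfer[OF a True, of x y] transfer[OF a True, of y x] x y eq by auto
        next
          case False
          then have lt: "\<delta> (r a x) < a" "\<delta> (r a y) < a"
            using \<delta>_r_le[OF x, of a] \<delta>_r_le[OF y, of a] by auto
          have *: "r a z = r b z" if "\<delta> (r a z) \<le> b" "b < a" "z \<in> topspace K" for b z
          proof -
            have "r a z = r b (r a z)"
              using r_fixed_iff[OF r_in_topspace[OF that(3)], of b a] that(1) by simp
            then show ?thesis using that by (simp add: r_r min_absorb1)
          qed
          \<comment> \<open>The larger of the two grades is one earlier stage at which both retracts
            are already attained, so a single use of the induction hypothesis suffices.\<close>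
          let ?b = "max (\<delta> (r a x)) (\<delta> (r a y))"
          have "?b < a" using lt by simp
          then show ?thesis using *[of x ?b] *[of y ?b] IH[of ?b] x y by simp
        qed
      next
        case False
        then show ?thesis using r_limit[OF x y] IH by blast
      qed
    qed
  qed
  then have "r \<omega>\<^sub>1 x = r \<omega>\<^sub>1 y"
    using r_limit[OF x y, of \<omega>\<^sub>1] omega1_pos successor_ordinal_omega1 by simp
  then show "x = y" using x y by (simp add: r_omega1)
qed

lemma path_r_eq:
  assumes A: "A \<in> paths T tle" and "s \<in> A" "t \<in> A" "\<delta> s \<le> \<delta> t"
  shows "r (\<delta> s) t = s"
proof (cases "s = t")
  case True
  then show ?thesis using path_subset[OF A] assms T_topspace r_fixed_iff by blast
next
  case False
  have "t \<notin> underS tle s" using tle_\<delta>_less[of t s] assms(4) by (auto simp: underS_def)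
  then have "s \<in> underS tle t" using path_total[OF A] assms False by blast
  then show ?thesis by (simp add: underS_def tle_def)
qed

lemma path_tle_closed:
  assumes A: "A \<in> paths T tle" and "t \<in> A" "(s, t) \<in> tle"
  shows "s \<in> A"
proof (cases "s = t")
  case False
  then have "s \<in> underS tle t" "s \<in> T" using assms(3) by (auto simp: underS_def tle_def)
  then show ?thesis using path_downward_closed[OF A assms(2)] by blast
qed (use assms in simp)

text \<open>Surjectivity of \<open>branch\<close> onto the paths. Compactness gives a point
  \<open>x\<close> whose branch contains \<open>A\<close>. If the branch is larger, its node of
  least grade outside \<open>A\<close> has a successor grade, and cutting \<open>x\<close> back to
  the predecessor stage leaves exactly \<open>A\<close>.\<close>

lemma path_eq_branch:
  assumes A: "A \<in> paths T tle"
  obtains x where "x \<in> topspace K" "A = branch x"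
proof -
  have AT: "A \<subseteq> T" and ne: "A \<noteq> {}" using A path_subset by (auto simp: paths_def)
  have "\<exists>x\<in>topspace K. \<forall>t\<in>A. x \<in> {x \<in> topspace K. r (\<delta> t) x \<in> {t}}"
  proof (rule compact_space_common_point[OF compact closedin_topspace])
    show "closedin K {x \<in> topspace K. r (\<delta> t) x \<in> {t}}" if "t \<in> A" for t
      using that AT T_topspace
      by (intro closedin_continuous_map_preimage[OF continuous_r] closedin_Hausdorff_singleton[OF Hausdorff]) auto
    fix J assume J: "finite J" "J \<subseteq> A"
    \<comment> \<open>A node of largest grade in \<open>J\<close>, or any node of \<open>A\<close>
      if \<open>J\<close> is empty, is itself the common point: by \<open>path_r_eq\<close> its
      retracts at the grades of \<open>J\<close> are the nodes of \<open>J\<close>.\<close>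
    obtain m where m: "m \<in> A" "\<And>t. t \<in> J \<Longrightarrow> \<delta> t \<le> \<delta> m"
    proof (cases "J = {}")
      case True
      then show thesis using ne that by auto
    next
      case False
      then have "Max (\<delta> ` J) \<in> \<delta> ` J" using J by simp
      then obtain m where "m \<in> J" "\<delta> m = Max (\<delta> ` J)" by auto
      then show thesis using that[of m] J by auto
    qed
    then have "m \<in> topspace K \<and> (\<forall>t\<in>J. r (\<delta> t) m = t)"
      using path_r_eq[OF A] J AT T_topspace by blast
    then show "\<exists>x\<in>topspace K. \<forall>t\<in>J. x \<in> {x \<in> topspace K. r (\<delta> t) x \<in> {t}}" by auto
  qed
  then obtain x where x: "x \<in> topspace K" and xA: "\<And>t. t \<in> A \<Longrightarrow> r (\<delta> t) x = t" by auto
  have sub: "A \<subseteq> branch x" using xA AT by (auto simp: branch_def)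
  show thesis
  proof (cases "A = branch x")
    case True
    then show thesis using x that by blast
  next
    case False
    then have "\<exists>a. \<exists>u\<in>branch x - A. \<delta> u = a" using sub by auto
    then have "\<exists>u\<in>branch x - A. \<delta> u = (LEAST a. \<exists>u\<in>branch x - A. \<delta> u = a)" by (rule LeastI_ex)
    then obtain u where u: "u \<in> branch x" "u \<notin> A" and least: "\<And>v. v \<in> branch x - A \<Longrightarrow> \<delta> u \<le> \<delta> v"
      by (metis (mono_tags, lifting) DiffD1 DiffD2 Least_le)
    obtain t where t: "t \<in> A" using ne by blast
    \<comment> \<open>With grade zero \<open>u\<close> would lie below a node of the nonempty path
      \<open>A\<close>, hence in \<open>A\<close>. As \<open>u\<close> is a node, its grade is then
      a successor and has a predecessor \<open>b\<close>.\<close>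
    have "\<delta> u \<noteq> 0"
    proof
      assume "\<delta> u = 0"
      then have "\<delta> u \<le> \<delta> t" using zero_le_ordinal by simp
      then have "(u, t) \<in> tle"
        using tle_trans_r[of u t x] u t sub x by (auto simp: branch_def)
      then show False using path_tle_closed[OF A t] u by blast
    qed
    then obtain b where b: "b < \<delta> u" "\<And>c. c < \<delta> u \<Longrightarrow> c \<le> b"
      using u by (auto simp: branch_def T_def successor_ordinal_def)
    \<comment> \<open>A node of \<open>A\<close> of grade at least \<open>\<delta> u\<close> would
      have \<open>u\<close> below it and force \<open>u\<close> into \<open>A\<close>; conversely,
      branch nodes of grade below \<open>\<delta> u\<close> are in \<open>A\<close> by the minimal
      choice of \<open>u\<close>.\<close>
    have "A = {t \<in> branch x. \<delta> t \<le> b}"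
    proof (intro equalityI subsetI)
      fix t assume t: "t \<in> A"
      have "\<delta> t \<le> b"
      proof (rule ccontr)
        assume "\<not> \<delta> t \<le> b"
        then have "\<delta> u \<le> \<delta> t" using b(2) by (meson not_le)
        then have "(u, t) \<in> tle"
          using tle_trans_r[of u t x] u t sub x by (auto simp: branch_def)
        then show False using path_tle_closed[OF A t] u by blast
      qed
      then show "t \<in> {t \<in> branch x. \<delta> t \<le> b}" using t sub by auto
    next
      fix t assume "t \<in> {t \<in> branch x. \<delta> t \<le> b}"
      then show "t \<in> A" using least[of t] b(1) by fastforce
    qed
    then have "A = branch (r b x)" using branch_r[OF x] by simp
    then show thesis using r_in_topspace[OF x] that by blast
  qed
qed

lemma branch_bij: "bij_betw branch (topspace K) (paths T tle)"
  unfolding bij_betw_def using branch_inj branch_in_paths path_eq_branch by blast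

lemma paths_level_eq_branch_image: "paths (level T \<delta> a) tle = branch ` (r a ` topspace K)"
proof -
  have gt: "graded_tree T tle \<delta>" using tle_graded by (simp add: graded_tree_below_def)
  show ?thesis
  proof (intro equalityI subsetI)
    fix A assume "A \<in> paths (level T \<delta> a) tle"
    then have A: "A \<in> paths T tle" "\<forall>t\<in>A. \<delta> t \<le> a" by (auto simp: paths_level_iff[OF gt])
    obtain x where x: "x \<in> topspace K" "A = branch x" using path_eq_branch[OF A(1)] by blast
    then have "A = branch (r a x)" using A(2) by (auto simp: branch_r)
    then show "A \<in> branch ` (r a ` topspace K)" using x by blast
  next
    fix A assume "A \<in> branch ` (r a ` topspace K)"
    then show "A \<in> paths (level T \<delta> a) tle"
      using branch_in_paths[OF r_in_topspace] by (auto simp: paths_level_iff[OF gt] branch_r)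
  qed
qed

text \<open>The topology of \<open>K\<close> is transported along \<open>branch\<close>. Conjugation
  by \<open>branch\<close> turns \<open>r a\<close> into the restriction to level \<open>a\<close>
  and the range of \<open>r a\<close> into the paths of level \<open>a\<close>, so continuity and
  metrizability carry over.\<close>

theorem tree_representation:
  assumes metr: "\<And>a. a < \<omega>\<^sub>1 \<Longrightarrow> metrizable_space (subtopology K (r a ` topspace K))"
  shows "\<exists>(T :: 'a set) le \<delta> X g.
    graded_tree_below \<omega>\<^sub>1 T le \<delta> \<and> compatible_topology T le \<delta> X \<and>
    (\<forall>a<\<omega>\<^sub>1. metrizable_space (subtopology X (paths (level T \<delta> a) le))) \<and>
    homeomorphic_map K X g \<and>
    g ` (\<Union>a\<in>{..<\<omega>\<^sub>1}. r a ` topspace K) = (\<Union>a\<in>{..<\<omega>\<^sub>1}. paths (level T \<delta> a) le) \<and>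
    (\<Union>a\<in>{..<\<omega>\<^sub>1}. paths (level T \<delta> a) le) = {A \<in> paths T le. countable A}"
proof -
  define h where "h = inv_into (topspace K) branch"
  define X where "X = pullback_topology (paths T tle) h K"
  have hom: "homeomorphic_maps K X branch h" and top: "topspace X = paths T tle"
    unfolding X_def h_def by (rule homeomorphic_maps_pullback_inv[OF branch_bij])+
  have hm: "homeomorphic_map K X branch" using hom homeomorphic_map_maps by blast
  have h: "h A \<in> topspace K" "branch (h A) = A" if "A \<in> paths T tle" for A
    using hom that by (auto simp: homeomorphic_maps_def top[symmetric] continuous_map_def)
  have "compact_space X" "Hausdorff_space X"
    using homeomorphic_compact_space homeomorphic_Hausdorff_space
      homeomorphic_map_imp_homeomorphic_space[OF hm] compact Hausdorff by blast+
  moreover have "continuous_map X X (path_restriction T \<delta> a)" for a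
  proof (rule continuous_map_eq)
    show "continuous_map X X (branch \<circ> (r a \<circ> h))"
      using hom by (auto simp: homeomorphic_maps_def intro!: continuous_map_compose continuous_r)
    fix A assume "A \<in> topspace X"
    then have A: "A \<in> paths T tle" by (simp add: top)
    have "branch (r a (h A)) = {t \<in> branch (h A). \<delta> t \<le> a}" by (rule branch_r[OF h(1)[OF A]])
    also have "\<dots> = path_restriction T \<delta> a A"
      unfolding h(2)[OF A] using path_subset[OF A] by (auto simp: path_restriction_def level_def)
    finally show "(branch \<circ> (r a \<circ> h)) A = path_restriction T \<delta> a A" by simp
  qed
  ultimately have "compatible_topology T tle \<delta> X" by (simp add: compatible_topology_def top)
  moreover have "metrizable_space (subtopology X (paths (level T \<delta> a) tle))" if "a < \<omega>\<^sub>1" for a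
  proof -
    have "branch ` (topspace K \<inter> r a ` topspace K) = topspace X \<inter> paths (level T \<delta> a) tle"
      using r_in_topspace branch_in_paths by (auto simp: paths_level_eq_branch_image top)
    then have "homeomorphic_map (subtopology K (r a ` topspace K)) (subtopology X (paths (level T \<delta> a) tle)) branch"
      by (rule homeomorphic_map_subtopologies[OF hm])
    then show ?thesis
      using metr[OF that] homeomorphic_map_imp_homeomorphic_space homeomorphic_metrizable_space by blast
  qed
  moreover have "branch ` (\<Union>a\<in>{..<\<omega>\<^sub>1}. r a ` topspace K) = (\<Union>a\<in>{..<\<omega>\<^sub>1}. paths (level T \<delta> a) tle)"
    by (simp add: paths_level_eq_branch_image image_UN)
  ultimately show ?thesis
    using tle_graded hm UN_paths_level_eq_countable_paths[OF tle_graded] by (intro exI conjI) auto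
qed

end

section \<open>Retractions of Valdivia compacta\<close>

lemma finite_subset_UN_chain:
  assumes "finite F" "F \<subseteq> (\<Union>n\<in>N. A n)" "N \<noteq> {}"
    and chain: "\<And>m n. m \<in> N \<Longrightarrow> n \<in> N \<Longrightarrow> A m \<subseteq> A n \<or> A n \<subseteq> A m"
  shows "\<exists>n\<in>N. F \<subseteq> A n"
  using assms(1,2)
proof (induction F)
  case empty
  then show ?case using assms(3) by blast
next
  case (insert x F)
  then obtain m n where "m \<in> N" "F \<subseteq> A m" "n \<in> N" "x \<in> A n" by auto
  then show ?case using chain[of m n] by blast
qed

text \<open>A dense \<Sigma>-subset in coordinates. The condition \<open>nonzero\<close> excludes
  coordinates vanishing on all of \<open>K\<close>, so that the size of \<open>I\<close> can be
  bounded by the weight.\<close>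

locale sigma_family = separating_family K I f
  for K :: "'a topology" and I :: "'i set" and f :: "'i \<Rightarrow> 'a \<Rightarrow> real" +
  fixes S :: "'a set"
  assumes Hausdorff: "Hausdorff_space K"
    and S_eq: "S = {x \<in> topspace K. countable {i \<in> I. f i x \<noteq> 0}}"
    and dense: "dense_in K S"
    and nonzero: "i \<in> I \<Longrightarrow> \<exists>x\<in>topspace K. f i x \<noteq> 0"
begin

abbreviation supp :: "'a \<Rightarrow> 'i set" where
  "supp x \<equiv> {i \<in> I. f i x \<noteq> 0}"

lemma S_meets_open:
  assumes "openin K U" "U \<noteq> {}"
  shows "S \<inter> U \<noteq> {}"
proof -
  obtain x where x: "x \<in> U" using assms(2) by blast
  then have "x \<in> K closure_of S"
    using dense openin_subset[OF assms(1)] by (auto simp: dense_in_def)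
  then show ?thesis using assms(1) x by (auto simp: in_closure_of)
qed

text \<open>From each base set that meets \<open>S\<close> one point of \<open>S\<close> is chosen;
  its support is countable. Every coordinate is nonzero on some nonempty base set, which meets
  \<open>S\<close> by density, so the coordinate lies in the support of the chosen point.\<close>

lemma card_index_le_omega1:
  assumes "weight K \<le>o cardSuc natLeq"
  shows "|I| \<le>o cardSuc natLeq"
proof -
  obtain B where B: "topology_base K B" "|B| \<le>o cardSuc natLeq"
    using assms unfolding weight_le_iff by blast
  define d where "d = (\<lambda>U. if S \<inter> U = {} then {} else supp (SOME x. x \<in> S \<inter> U))"
  have some: "(SOME x. x \<in> S \<inter> U) \<in> S \<inter> U" if "S \<inter> U \<noteq> {}" for U
    using that by (intro some_in_eq[THEN iffD2])
  have "countable (d U)" for U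
    using some[of U] by (auto simp: d_def S_eq)
  then have "|\<Union>U\<in>B. d U| \<le>o cardSuc natLeq"
    using B(2) by (intro card_UN_countable_le_omega1)
  moreover have "I \<subseteq> (\<Union>U\<in>B. d U)"
  proof
    fix i assume i: "i \<in> I"
    then obtain x where x: "x \<in> topspace K" "f i x \<noteq> 0" using nonzero by blast
    have "openin K {x \<in> topspace K. f i x \<in> - {0}}"
      by (rule openin_continuous_map_preimage[OF cont[OF i]]) auto
    moreover have "x \<in> {x \<in> topspace K. f i x \<in> - {0}}" using x by simp
    ultimately obtain U where U: "U \<in> B" "x \<in> U" "U \<subseteq> {x \<in> topspace K. f i x \<in> - {0}}"
      using B(1) unfolding topology_base_def by meson
    then have ne: "S \<inter> U \<noteq> {}"
      using S_meets_open[of U] B(1) by (auto simp: topology_base_def)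
    then have "f i (SOME x. x \<in> S \<inter> U) \<noteq> 0" using some[OF ne] U(3) by auto
    then have "i \<in> d U" using i ne by (simp add: d_def)
    then show "i \<in> (\<Union>U\<in>B. d U)" using U(1) by blast
  qed
  ultimately show ?thesis by (meson card_of_mono1 ordLeq_transitive)
qed

section \<open>Saturated sets of coordinates\<close>

definition pick :: "('i \<times> real \<times> real) set \<Rightarrow> 'a" where
  "pick J = (SOME x. x \<in> S \<inter> coord_box K f J)"

text \<open>The picked points lie in the dense set \<open>S\<close> and approximate every point of \<open>K\<close> on the
  coordinates in a saturated set \<open>A\<close> while vanishing outside \<open>A\<close>; by compactness every point of
  \<open>K\<close> then remains in \<open>K\<close> when its coordinates outside \<open>A\<close> are replaced by zero. As the condition
  is finitary with countable conclusions, saturated hulls preserve countability and commute with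
  unions of chains.\<close>

definition saturated :: "'i set \<Rightarrow> bool" where
  "saturated A \<longleftrightarrow> (\<forall>J. finite J \<longrightarrow> J \<subseteq> A \<times> \<rat> \<times> \<rat> \<longrightarrow> coord_box K f J \<noteq> {} \<longrightarrow> supp (pick J) \<subseteq> A)"

lemma pick_in:
  assumes "finite J" "J \<subseteq> I \<times> \<rat> \<times> \<rat>" "coord_box K f J \<noteq> {}"
  shows "pick J \<in> S \<inter> coord_box K f J"
proof -
  have "openin K (coord_box K f J)"
    using assms cont by (intro openin_coord_box) auto
  then show ?thesis
    unfolding pick_def using S_meets_open[OF _ assms(3)] by (intro some_in_eq[THEN iffD2])
qed

lemma saturated_Inter: "(\<And>A. A \<in> \<A> \<Longrightarrow> saturated A) \<Longrightarrow> saturated (\<Inter>\<A>)"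
  unfolding saturated_def
proof (intro allI impI Inter_greatest)
  fix J A
  assume sat: "\<And>A. A \<in> \<A> \<Longrightarrow> \<forall>J. finite J \<longrightarrow> J \<subseteq> A \<times> \<rat> \<times> \<rat> \<longrightarrow> coord_box K f J \<noteq> {} \<longrightarrow> supp (pick J) \<subseteq> A"
    and J: "finite J" "J \<subseteq> \<Inter>\<A> \<times> \<rat> \<times> \<rat>" "coord_box K f J \<noteq> {}" and A: "A \<in> \<A>"
  have "J \<subseteq> A \<times> \<rat> \<times> \<rat>" using J(2) A by blast
  then show "supp (pick J) \<subseteq> A" using sat[OF A] J by blast
qed

lemma saturated_hull: "saturated (saturated hull B)"
  by (rule hull_in) (simp add: saturated_Inter)

text \<open>A finite \<open>J\<close> mentions finitely many coordinates, all of which lie in one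
  member of the chain. The hypothesis \<open>step\<close> only asks for supports inside the union,
  so the lemma also covers chains whose members are not saturated themselves.\<close>

lemma saturated_UN_chain:
  assumes "N \<noteq> {}" "\<And>m n. m \<in> N \<Longrightarrow> n \<in> N \<Longrightarrow> A m \<subseteq> A n \<or> A n \<subseteq> A m"
    and step: "\<And>n J. n \<in> N \<Longrightarrow> finite J \<Longrightarrow> J \<subseteq> A n \<times> \<rat> \<times> \<rat> \<Longrightarrow> coord_box K f J \<noteq> {} \<Longrightarrow>
      supp (pick J) \<subseteq> (\<Union>n\<in>N. A n)"
  shows "saturated (\<Union>n\<in>N. A n)"
  unfolding saturated_def
proof (intro allI impI)
  fix J assume J: "finite J" "J \<subseteq> (\<Union>n\<in>N. A n) \<times> \<rat> \<times> \<rat>" "coord_box K f J \<noteq> {}"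
  then have "finite (fst ` J)" "fst ` J \<subseteq> (\<Union>n\<in>N. A n)" by auto
  from finite_subset_UN_chain[OF this assms(1,2)]
  obtain n where n: "n \<in> N" "fst ` J \<subseteq> A n" by blast
  then have "J \<subseteq> A n \<times> \<rat> \<times> \<rat>" using J(2) by force
  then show "supp (pick J) \<subseteq> (\<Union>n\<in>N. A n)" using step[OF n(1) J(1) _ J(3)] by simp
qed

text \<open>The hulls again form a chain, so their union is saturated. This makes the exhaustion of
  the index set continuous at limit ordinals.\<close>

lemma hull_UN_chain:
  assumes "N \<noteq> {}" "\<And>m n. m \<in> N \<Longrightarrow> n \<in> N \<Longrightarrow> B m \<subseteq> B n \<or> B n \<subseteq> B m"
  shows "saturated hull (\<Union>n\<in>N. B n) = (\<Union>n\<in>N. saturated hull (B n))"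
proof
  have "saturated (\<Union>n\<in>N. saturated hull (B n))"
  proof (rule saturated_UN_chain[OF assms(1)])
    show "saturated hull B m \<subseteq> saturated hull B n \<or> saturated hull B n \<subseteq> saturated hull B m"
      if "m \<in> N" "n \<in> N" for m n
      using assms(2)[OF that] hull_mono by metis
    show "supp (pick J) \<subseteq> (\<Union>n\<in>N. saturated hull (B n))"
      if "n \<in> N" "finite J" "J \<subseteq> (saturated hull (B n)) \<times> \<rat> \<times> \<rat>" "coord_box K f J \<noteq> {}" for n J
    proof -
      have "supp (pick J) \<subseteq> saturated hull (B n)"
        using saturated_hull[of "B n"] that(2-4) unfolding saturated_def by simp
      then show ?thesis using that(1) by auto
    qed
  qed
  moreover have "(\<Union>n\<in>N. B n) \<subseteq> (\<Union>n\<in>N. saturated hull (B n))"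
    by (intro UN_mono order_refl hull_subset)
  ultimately show "saturated hull (\<Union>n\<in>N. B n) \<subseteq> (\<Union>n\<in>N. saturated hull (B n))"
    by (intro hull_minimal)
  show "(\<Union>n\<in>N. saturated hull (B n)) \<subseteq> saturated hull (\<Union>n\<in>N. B n)"
    by (intro UN_least hull_mono) auto
qed

lemma saturated_index_set: "saturated I"
  by (auto simp: saturated_def)

lemma hull_subset_index_set: "B \<subseteq> I \<Longrightarrow> saturated hull B \<subseteq> I"
  by (rule hull_minimal[where S = saturated]) (use saturated_index_set in auto)

text \<open>The supports of all picked points are added \<omega> times. Each stage remains
  countable: a countable set of coordinates has countably many finite sets of rational constraints,
  and the picked points lie in \<open>S\<close>, so their supports are countable.\<close>

lemma countable_hull:
  assumes "countable B" "B \<subseteq> I"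
  shows "countable (saturated hull B)"
proof -
  define boxes where "boxes = (\<lambda>A. {J. finite J \<and> J \<subseteq> A \<times> (\<rat> :: real set) \<times> (\<rat> :: real set) \<and> coord_box K f J \<noteq> {}})"
  define A where "A = rec_nat B (\<lambda>_ A. A \<union> (\<Union>J\<in>boxes A. supp (pick J)))"
  have A0: "A 0 = B" and AS: "A (Suc n) = A n \<union> (\<Union>J\<in>boxes (A n). supp (pick J))" for n
    by (auto simp: A_def)
  have AI: "A n \<subseteq> I" for n
    by (induction n) (use assms(2) in \<open>auto simp: A0 AS\<close>)
  have cA: "countable (A n)" for n
  proof (induction n)
    case 0
    then show ?case using assms(1) by (simp add: A0)
  next
    case (Suc n)
    have "countable {J. finite J \<and> J \<subseteq> A n \<times> (\<rat> :: real set) \<times> (\<rat> :: real set)}"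
      by (intro countable_Collect_finite_subset countable_SIGMA Suc countable_rat)
    then have "countable (boxes (A n))"
      by (rule countable_subset[rotated]) (auto simp: boxes_def)
    moreover have "countable (supp (pick J))" if "J \<in> boxes (A n)" for J
    proof -
      have "J \<subseteq> I \<times> \<rat> \<times> \<rat>" using that AI[of n] by (auto simp: boxes_def)
      then show ?thesis using pick_in[of J] that by (auto simp: boxes_def S_eq)
    qed
    ultimately show ?case unfolding AS using Suc by auto
  qed
  have mono: "A m \<subseteq> A n" if "m \<le> n" for m n
    using that by (rule lift_Suc_mono_le[of A, rotated]) (auto simp: AS)
  have "saturated (\<Union>n\<in>UNIV. A n)"
  proof (rule saturated_UN_chain)
    show "A m \<subseteq> A n \<or> A n \<subseteq> A m" for m n using mono nat_le_linear by blast
    fix n J assume "finite J" "J \<subseteq> A n \<times> \<rat> \<times> \<rat>" "coord_box K f J \<noteq> {}"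
    then have "J \<in> boxes (A n)" by (simp add: boxes_def)
    then have "supp (pick J) \<subseteq> A (Suc n)" unfolding AS by blast
    then show "supp (pick J) \<subseteq> (\<Union>n\<in>UNIV. A n)" by blast
  qed simp
  then have "saturated hull B \<subseteq> (\<Union>n. A n)"
    using A0 by (intro hull_minimal) auto
  then show ?thesis using cA countable_subset by (metis countable_UN countableI_type)
qed

text \<open>Finitely many constraints are met by the point picked for those on coordinates in
  \<open>A\<close>: saturation keeps its support inside \<open>A\<close>, so its other coordinates
  vanish as required. Compactness then yields a point meeting all constraints.\<close>

lemma saturated_restriction_exists:
  assumes "saturated A" "A \<subseteq> I" "x \<in> topspace K"
  shows "\<exists>y\<in>topspace K. \<forall>i\<in>I. f i y = (if i \<in> A then f i x else 0)"
proof -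
  define D where "D = {(i, p, q). i \<in> I \<and> p \<in> \<rat> \<and> q \<in> \<rat> \<and> p < f i x \<and> f i x < q}"
  \<comment> \<open>For a coordinate outside \<open>A\<close> both bounds are replaced by zero, so
    the slab demands the value zero exactly.\<close>
  define C where "C = (\<lambda>(i, p, q). {y \<in> topspace K.
    (if i \<in> A then p else 0) \<le> f i y \<and> f i y \<le> (if i \<in> A then q else 0)})"
  have "\<exists>y\<in>topspace K. \<forall>j\<in>D. y \<in> C j"
  proof (rule compact_space_common_point[OF compact closedin_topspace])
    show "closedin K (C j)" if "j \<in> D" for j
      using that closedin_coord_slab[OF cont] by (auto simp: D_def C_def simp del: if_split)
    fix J assume J: "finite J" "J \<subseteq> D"
    define J' where "J' = {j \<in> J. fst j \<in> A}"
    have J': "finite J'" "J' \<subseteq> A \<times> \<rat> \<times> \<rat>" "J' \<subseteq> I \<times> \<rat> \<times> \<rat>" "x \<in> coord_box K f J'"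
      using J assms(3) by (auto simp: J'_def D_def coord_box_def)
    then have ne: "coord_box K f J' \<noteq> {}" by blast
    define y where "y = pick J'"
    have y: "y \<in> coord_box K f J'" using pick_in[OF J'(1,3) ne] by (simp add: y_def)
    have supp: "supp y \<subseteq> A"
      using assms(1) J'(1,2) ne unfolding saturated_def y_def by blast
    have "y \<in> C j" if j: "j \<in> J" for j
    proof -
      obtain i p q where ipq: "j = (i, p, q)" by (metis prod.exhaust)
      have "i \<in> I" using j J(2) ipq by (auto simp: D_def)
      show ?thesis
      proof (cases "i \<in> A")
        case True
        then have "(i, p, q) \<in> J'" using j ipq by (simp add: J'_def)
        then show ?thesis using y True by (auto simp: C_def ipq coord_box_def)
      next
        case False
        then have "f i y = 0" using supp \<open>i \<in> I\<close> by blast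
        then show ?thesis using y False by (auto simp: C_def ipq coord_box_def)
      qed
    qed
    moreover have "y \<in> topspace K" using y by (simp add: coord_box_def)
    ultimately show "\<exists>y\<in>topspace K. \<forall>j\<in>J. y \<in> C j" by blast
  qed
  then obtain y where y: "y \<in> topspace K" "\<And>j. j \<in> D \<Longrightarrow> y \<in> C j" by blast
  have "f i y = (if i \<in> A then f i x else 0)" if i: "i \<in> I" for i
  proof (cases "i \<in> A")
    case True
    have "f i x = f i y"
    proof (rule real_eqI_rational_intervals)
      fix p q :: real assume "p \<in> \<rat>" "q \<in> \<rat>" "p < f i x" "f i x < q"
      then have "(i, p, q) \<in> D" using i by (auto simp: D_def)
      then show "p \<le> f i y \<and> f i y \<le> q" using y(2)[of "(i, p, q)"] True by (auto simp: C_def)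
    qed
    then show ?thesis using True by simp
  next
    case False
    \<comment> \<open>One rational interval around \<open>f i x\<close> suffices here: it puts
      coordinate \<open>i\<close> into \<open>D\<close>, and outside \<open>A\<close> the resulting
      slab already forces the value zero.\<close>
    obtain p q where "p \<in> \<rat>" "p < f i x" "q \<in> \<rat>" "f i x < q"
      using Rats_dense_in_real[of "f i x - 1" "f i x"] Rats_dense_in_real[of "f i x" "f i x + 1"] by auto
    then have "(i, p, q) \<in> D" using i by (auto simp: D_def)
    then show ?thesis using y(2)[of "(i, p, q)"] False by (auto simp: C_def)
  qed
  then show ?thesis using y(1) by blast
qed

theorem retraction_sequence_exists:
  assumes "weight K \<le>o cardSuc natLeq"
  obtains r where "retraction_sequence K r"
    "\<And>a. a < \<omega>\<^sub>1 \<Longrightarrow> metrizable_space (subtopology K (r a ` topspace K))"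
    "S = (\<Union>a\<in>{..<\<omega>\<^sub>1}. r a ` topspace K)"
proof -
  obtain h where h: "inj_on h I" "h ` I \<subseteq> {..<\<omega>\<^sub>1}"
    using card_le_omega1_imp_inj[OF card_index_le_omega1[OF assms]] by metis
  define B where "B = (\<lambda>a. {i \<in> I. h i < a})"
  define A where "A = (\<lambda>a. saturated hull (B a))"
  \<comment> \<open>Such a point exists by \<open>saturated_restriction_exists\<close> and is unique
    because the coordinates separate points, so the choice is immaterial.\<close>
  define r where "r = (\<lambda>a x. SOME y. y \<in> topspace K \<and> (\<forall>i\<in>I. f i y = (if i \<in> A a then f i x else 0)))"
  have BI: "B a \<subseteq> I" for a by (auto simp: B_def)
  have BA: "B a \<subseteq> A a" for a unfolding A_def by (rule hull_subset)
  have AI: "A a \<subseteq> I" for a unfolding A_def by (rule hull_subset_index_set[OF BI])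
  have B_mono: "a \<le> b \<Longrightarrow> B a \<subseteq> B b" for a b by (auto simp: B_def)
  then have A_mono: "a \<le> b \<Longrightarrow> A a \<subseteq> A b" for a b unfolding A_def by (simp add: hull_mono)
  have cA: "countable (A a)" if "a < \<omega>\<^sub>1" for a
    unfolding A_def
  proof (rule countable_hull[OF _ BI])
    have "countable (h ` B a)"
      by (rule countable_subset[OF _ countable_lessThan_ordinal[OF that]]) (auto simp: B_def)
    then show "countable (B a)"
      by (rule countable_image_inj_on) (rule inj_on_subset[OF h(1) BI])
  qed
  \<comment> \<open>Below a limit \<open>a\<close> there is room for some \<open>b\<close> between
    \<open>h i\<close> and \<open>a\<close>, so \<open>B a\<close> is the union of the earlier
    \<open>B b\<close>; hulls commute with this union.\<close>
  have A_limit: "A a = (\<Union>b\<in>{..<a}. A b)" if a: "a \<noteq> 0" "\<not> successor_ordinal a" for a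
  proof -
    have "0 < a" using a(1) zero_le_ordinal[of a] by (simp add: order_less_le)
    then have "{..<a} \<noteq> {}" by auto
    moreover have "B a = (\<Union>b\<in>{..<a}. B b)"
    proof (intro equalityI subsetI)
      fix i assume "i \<in> B a"
      then have "i \<in> I" "h i < a" by (auto simp: B_def)
      then obtain b where "h i < b" "b < a" using limit_ordinal_between[OF a(2)] by metis
      then show "i \<in> (\<Union>b\<in>{..<a}. B b)" using \<open>i \<in> I\<close> by (auto simp: B_def)
    next
      fix i assume "i \<in> (\<Union>b\<in>{..<a}. B b)"
      then show "i \<in> B a" by (auto simp: B_def)
    qed
    ultimately show ?thesis
      unfolding A_def using B_mono by (metis hull_UN_chain linear)
  qed
  have r: "r a x \<in> topspace K" "\<And>i. i \<in> I \<Longrightarrow> f i (r a x) = (if i \<in> A a then f i x else 0)"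
    if "x \<in> topspace K" for a x
  proof -
    have "saturated (A a)" unfolding A_def by (rule saturated_hull)
    then have "\<exists>y. y \<in> topspace K \<and> (\<forall>i\<in>I. f i y = (if i \<in> A a then f i x else 0))"
      using saturated_restriction_exists[OF _ AI that] by blast
    then have "r a x \<in> topspace K \<and> (\<forall>i\<in>I. f i (r a x) = (if i \<in> A a then f i x else 0))"
      unfolding r_def by (rule someI_ex)
    then show "r a x \<in> topspace K" "\<And>i. i \<in> I \<Longrightarrow> f i (r a x) = (if i \<in> A a then f i x else 0)"
      by auto
  qed
  have r_fixed: "r a x = x \<longleftrightarrow> supp x \<subseteq> A a" if x: "x \<in> topspace K" for a x
  proof
    assume eq: "r a x = x"
    show "supp x \<subseteq> A a"
    proof
      fix i assume "i \<in> supp x"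
      then show "i \<in> A a" using r(2)[OF x, of i a] eq by (auto split: if_splits)
    qed
  next
    assume "supp x \<subseteq> A a"
    then show "r a x = x"
      using r[OF x] x by (intro separating) auto
  qed
  have "retraction_sequence K r"
  proof
    show "compact_space K" "Hausdorff_space K" by (fact compact Hausdorff)+
    show "continuous_map K K (r a)" for a
    proof (rule continuous_map_into)
      show "r a ` topspace K \<subseteq> topspace K" using r(1) by blast
      fix i assume i: "i \<in> I"
      show "continuous_map K euclideanreal (\<lambda>x. f i (r a x))"
      proof (rule continuous_map_eq)
        show "continuous_map K euclideanreal (if i \<in> A a then f i else (\<lambda>_. 0))"
          using cont[OF i] by simp
        show "(if i \<in> A a then f i else (\<lambda>_. 0)) x = f i (r a x)" if "x \<in> topspace K" for x
          using r(2)[OF that i] by simp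
      qed
    qed
    show "r a (r b x) = r (min a b) x" if x: "x \<in> topspace K" for a b x
    proof (rule separating)
      fix i assume i: "i \<in> I"
      \<comment> \<open>The sets \<open>A a\<close> are nested, so restricting to two of them
        successively restricts to the smaller one.\<close>
      have "i \<in> A (min a b) \<longleftrightarrow> i \<in> A a \<and> i \<in> A b"
        using A_mono[of a b] A_mono[of b a] linear[of a b] by (auto simp: min_def)
      then show "f i (r a (r b x)) = f i (r (min a b) x)"
        using i x r by simp
    qed (use r x in auto)
    show "r a x = r a y"
      if x: "x \<in> topspace K" and y: "y \<in> topspace K" and a: "a \<noteq> 0" "\<not> successor_ordinal a"
        and eq: "\<And>b. b < a \<Longrightarrow> r b x = r b y" for a x y
    proof (rule separating)
      fix i assume i: "i \<in> I"
      show "f i (r a x) = f i (r a y)"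
      proof (cases "i \<in> A a")
        case True
        then obtain b where "b < a" "i \<in> A b" using A_limit[OF a] by auto
        then have "f i x = f i y"
          using r(2)[OF x i, of b] r(2)[OF y i, of b] eq[of b] by simp
        then show ?thesis using r(2)[OF x i] r(2)[OF y i] by simp
      next
        case False
        then show ?thesis using r(2)[OF x i] r(2)[OF y i] by simp
      qed
    qed (use r x y in auto)
    show "r \<omega>\<^sub>1 x = x" if "x \<in> topspace K" for x
    proof -
      have "B \<omega>\<^sub>1 = I" using h(2) by (auto simp: B_def)
      then show ?thesis using r_fixed[OF that] BA[of "\<omega>\<^sub>1"] by auto
    qed
  qed
  moreover have "metrizable_space (subtopology K (r a ` topspace K))" if a: "a < \<omega>\<^sub>1" for a
  proof (rule separating_family_metrizable)
    interpret R: retraction_sequence K r by fact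
    have top: "topspace (subtopology K (r a ` topspace K)) = r a ` topspace K"
      using r(1) by auto
    show "separating_family (subtopology K (r a ` topspace K)) (A a) f"
    proof
      have "compactin K (r a ` topspace K)"
        using compact R.continuous_r image_compactin unfolding compact_space_def by blast
      then show "compact_space (subtopology K (r a ` topspace K))" by (rule compact_space_subtopology)
      show "continuous_map (subtopology K (r a ` topspace K)) euclideanreal (f i)" if "i \<in> A a" for i
        using cont that AI by (intro continuous_map_from_subtopology) auto
      fix x y
      assume "x \<in> topspace (subtopology K (r a ` topspace K))" "y \<in> topspace (subtopology K (r a ` topspace K))"
        and eq: "\<And>i. i \<in> A a \<Longrightarrow> f i x = f i y"
      then obtain u v where uv: "u \<in> topspace K" "x = r a u" "v \<in> topspace K" "y = r a v"
        unfolding top by blast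
      \<comment> \<open>Points in the range of \<open>r a\<close> vanish outside \<open>A a\<close>,
        so the countably many coordinates in \<open>A a\<close> already separate them.\<close>
      show "x = y"
      proof (rule separating)
        fix i assume "i \<in> I"
        then show "f i x = f i y"
          using eq[of i] r(2)[OF uv(1), of i a] r(2)[OF uv(3), of i a] uv(2,4)
          by (cases "i \<in> A a") auto
      qed (use r uv in auto)
    qed
  qed (rule cA[OF a])
  moreover have "S = (\<Union>a\<in>{..<\<omega>\<^sub>1}. r a ` topspace K)"
  proof (intro equalityI subsetI)
    fix x assume "x \<in> S"
    then have x: "x \<in> topspace K" "countable (supp x)" by (auto simp: S_eq)
    \<comment> \<open>A countable support has bounded image under \<open>h\<close> and is thus
      contained in some \<open>B a\<close> with \<open>a < \<omega>\<^sub>1\<close>.\<close>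
    then have "countable (h ` supp x)" "h ` supp x \<subseteq> {..<\<omega>\<^sub>1}" using h(2) by auto
    then obtain a where a: "a < \<omega>\<^sub>1" "\<And>c. c \<in> h ` supp x \<Longrightarrow> c < a"
      using countable_ordinals_bounded by metis
    then have "supp x \<subseteq> B a" by (auto simp: B_def)
    then have "r a x = x" using r_fixed[OF x(1)] BA by blast
    then show "x \<in> (\<Union>a\<in>{..<\<omega>\<^sub>1}. r a ` topspace K)" using a(1) x(1) by force
  next
    fix x assume "x \<in> (\<Union>a\<in>{..<\<omega>\<^sub>1}. r a ` topspace K)"
    then obtain a y where a: "a < \<omega>\<^sub>1" "y \<in> topspace K" "x = r a y" by auto
    then have "supp x \<subseteq> A a" using r(2)[OF a(2), of _ a] by (auto split: if_splits)
    then show "x \<in> S"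
      using countable_subset[OF _ cA[OF a(1)]] r(1)[OF a(2)] a(3) by (simp add: S_eq)
  qed
  ultimately show thesis by (rule that)
qed

end

text \<open>Coordinates vanishing on all of \<open>K\<close> are discarded; this affects neither the
  separation of points nor the supports of points of \<open>K\<close>.\<close>

lemma sigma_family_of_Sigma_subset:
  fixes K :: "'a topology"
  assumes "Valdivia K" "Sigma_subset K S" "dense_in K S"
  obtains I :: "(('a \<Rightarrow> real) \<times> real) set" and f where "sigma_family K I f S"
proof -
  obtain \<Gamma> :: "(('a \<Rightarrow> real) \<times> real) set" and \<phi> where
    cont: "continuous_map K (powertop_real \<Gamma>) \<phi>" and inj: "inj_on \<phi> (topspace K)"
    and S: "S = {x \<in> topspace K. \<phi> x \<in> Sigma_product \<Gamma>}"
    using assms(2) by (auto simp: Sigma_subset_def Sigma_subset_via_def)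
  define f where "f = (\<lambda>\<gamma> x. \<phi> x \<gamma>)"
  define I where "I = {\<gamma> \<in> \<Gamma>. \<exists>x\<in>topspace K. f \<gamma> x \<noteq> 0}"
  have ext: "\<phi> x \<in> topspace (powertop_real \<Gamma>)" if "x \<in> topspace K" for x
    using continuous_map_image_subset_topspace[OF cont] that by blast
  have "sigma_family K I f S"
  proof
    show "compact_space K" "Hausdorff_space K" using assms(1) by (auto simp: Valdivia_def)
    show "dense_in K S" by fact
    show "continuous_map K euclideanreal (f \<gamma>)" if "\<gamma> \<in> I" for \<gamma>
      using cont that by (auto simp: continuous_map_componentwise f_def I_def)
    show "\<exists>x\<in>topspace K. f i x \<noteq> 0" if "i \<in> I" for i using that by (simp add: I_def)
    show "x = y" if xy: "x \<in> topspace K" "y \<in> topspace K" and eq: "\<And>i. i \<in> I \<Longrightarrow> f i x = f i y" for x y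
    proof -
      have "\<phi> x \<gamma> = \<phi> y \<gamma>" if "\<gamma> \<in> \<Gamma>" for \<gamma>
        using that xy eq[of \<gamma>] by (cases "\<gamma> \<in> I") (auto simp: I_def f_def)
      moreover have "\<phi> x \<in> extensional \<Gamma>" "\<phi> y \<in> extensional \<Gamma>"
        using ext xy by (auto simp: PiE_def)
      ultimately have "\<phi> x = \<phi> y" by (meson extensionalityI)
      then show ?thesis using inj xy by (meson inj_onD)
    qed
    have "{i \<in> I. f i x \<noteq> 0} = {\<gamma> \<in> \<Gamma>. \<phi> x \<gamma> \<noteq> 0}" if "x \<in> topspace K" for x
      using that by (auto simp: I_def f_def)
    then show "S = {x \<in> topspace K. countable {i \<in> I. f i x \<noteq> 0}}"
      unfolding S Sigma_product_def using ext by (auto simp del: topspace_product_topology)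
  qed
  then show thesis by (rule that)
qed

theorem Valdivia_tree_representation:
  fixes K :: "'a topology"
  assumes "Valdivia K" "weight K \<le>o cardSuc natLeq" "Sigma_subset K S" "dense_in K S"
  shows "\<exists>(T :: 'a set) r \<delta> X g.
    graded_tree_below \<omega>\<^sub>1 T r \<delta> \<and> compatible_topology T r \<delta> X \<and>
    (\<forall>\<alpha><\<omega>\<^sub>1. metrizable_space (subtopology X (paths (level T \<delta> \<alpha>) r))) \<and>
    homeomorphic_map K X g \<and>
    g ` S = (\<Union>\<alpha>\<in>{..<\<omega>\<^sub>1}. paths (level T \<delta> \<alpha>) r) \<and>
    (\<Union>\<alpha>\<in>{..<\<omega>\<^sub>1}. paths (level T \<delta> \<alpha>) r) = {A \<in> paths T r. countable A}"
proof -
  obtain I f where "sigma_family K (I :: (('a \<Rightarrow> real) \<times> real) set) f S"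
    using sigma_family_of_Sigma_subset[OF assms(1,3,4)] by metis
  then obtain r where r: "retraction_sequence K r"
    "\<And>a. a < \<omega>\<^sub>1 \<Longrightarrow> metrizable_space (subtopology K (r a ` topspace K))"
    and S: "S = (\<Union>a\<in>{..<\<omega>\<^sub>1}. r a ` topspace K)"
    using sigma_family.retraction_sequence_exists[OF _ assms(2)] by metis
  show ?thesis unfolding S by (rule retraction_sequence.tree_representation[OF r])
qed

section \<open>Path spaces of graded trees\<close>

locale compatible_tree =
  fixes T :: "'t set" and r \<delta> and X :: "'t set topology"
  assumes below: "graded_tree_below \<omega>\<^sub>1 T r \<delta>"
    and compatible: "compatible_topology T r \<delta> X"
    and metrizable: "\<And>a. a < \<omega>\<^sub>1 \<Longrightarrow> metrizable_space (subtopology X (paths (level T \<delta> a) r))"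
begin

abbreviation \<rho> :: "ordinal \<Rightarrow> 't set \<Rightarrow> 't set" where
  "\<rho> a \<equiv> path_restriction T \<delta> a"

abbreviation P :: "ordinal \<Rightarrow> 't set set" where
  "P a \<equiv> paths (level T \<delta> a) r"

lemma graded: "graded_tree T r \<delta>"
  using below by (simp add: graded_tree_below_def)

lemma grade_less: "t \<in> T \<Longrightarrow> \<delta> t < \<omega>\<^sub>1"
  using below by (simp add: graded_tree_below_def)

lemma grade_cases: "t \<in> T \<Longrightarrow> successor_ordinal (\<delta> t) \<or> \<delta> t = 0"
  using graded by (simp add: graded_tree_def)

lemma compact: "compact_space X" and Hausdorff: "Hausdorff_space X"
  and topspace_eq: "topspace X = paths T r" and continuous_\<rho>: "continuous_map X X (\<rho> a)"
  using compatible by (auto simp: compatible_topology_def)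

lemma mem_\<rho>: "A \<in> paths T r \<Longrightarrow> t \<in> \<rho> a A \<longleftrightarrow> t \<in> A \<and> \<delta> t \<le> a"
  using path_subset[of A T r] by (auto simp: path_restriction_def level_def)

lemma \<rho>_path: "A \<in> paths T r \<Longrightarrow> \<rho> a A \<in> paths T r"
  using continuous_map_image_subset_topspace[OF continuous_\<rho>] unfolding topspace_eq by blast

lemma \<rho>_in_P:
  assumes "A \<in> paths T r" "a \<le> b"
  shows "\<rho> a A \<in> P b"
proof -
  have "\<forall>t\<in>\<rho> a A. \<delta> t \<le> b"
    using mem_\<rho>[OF assms(1)] assms(2) by (meson order_trans)
  then show ?thesis using \<rho>_path[OF assms(1)] by (simp add: paths_level_iff[OF graded])
qed

lemma P_subset: "P a \<subseteq> paths T r"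
  by (auto simp: paths_level_iff[OF graded])

lemma \<rho>_P: "A \<in> P a \<Longrightarrow> \<rho> a A = A"
  using mem_\<rho>[of A _ a] by (auto simp: paths_level_iff[OF graded])

lemma topspace_P: "topspace (subtopology X (P a)) = P a"
  using P_subset by (auto simp: topspace_eq)

lemma continuous_\<rho>_P: "a \<le> b \<Longrightarrow> continuous_map X (subtopology X (P b)) (\<rho> a)"
  using continuous_\<rho> \<rho>_in_P by (auto simp: continuous_map_in_subtopology topspace_eq)

text \<open>The map \<open>\<rho> a\<close> fixes the elements of \<open>P a\<close>, so
  \<open>P a\<close> is the continuous image of the compact space \<open>X\<close>.\<close>

lemma compact_P: "compact_space (subtopology X (P a))"
proof (rule compact_space_subtopology)
  have "\<rho> a ` topspace X = P a"
    unfolding topspace_eq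
  proof (intro equalityI subsetI)
    show "A \<in> P a" if "A \<in> \<rho> a ` paths T r" for A using that \<rho>_in_P by blast
    show "A \<in> \<rho> a ` paths T r" if "A \<in> P a" for A using \<rho>_P[OF that] P_subset that by force
  qed
  then show "compactin X (P a)"
    using image_compactin[OF _ continuous_\<rho>] compact unfolding compact_space_def by metis
qed

text \<open>A path \<open>A\<close> is approximated by its restrictions \<open>\<rho> a A\<close>.
  If a neighbourhood of \<open>A\<close> missed all of them, compactness would give a path outside
  it with the same restrictions below \<open>\<omega>\<^sub>1\<close>; since all grades are below
  \<open>\<omega>\<^sub>1\<close>, that path is \<open>A\<close>.\<close>

lemma dense_countable_paths: "dense_in X (\<Union>a\<in>{..<\<omega>\<^sub>1}. P a)"
  unfolding dense_in_def
proof (intro conjI subset_antisym closure_of_subset_topspace)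
  show "(\<Union>a\<in>{..<\<omega>\<^sub>1}. P a) \<subseteq> topspace X" using P_subset topspace_eq by blast
  show "topspace X \<subseteq> X closure_of (\<Union>a\<in>{..<\<omega>\<^sub>1}. P a)"
  proof
    fix A assume "A \<in> topspace X"
    then have A: "A \<in> paths T r" by (simp add: topspace_eq)
    have "\<exists>a<\<omega>\<^sub>1. \<rho> a A \<in> U" if U: "openin X U" "A \<in> U" for U
    proof (rule ccontr)
      assume no: "\<not> ?thesis"
      have "\<exists>B\<in>topspace X - U. \<forall>a\<in>{..<\<omega>\<^sub>1}. B \<in> {B \<in> topspace X. \<rho> a B \<in> {\<rho> a A}}"
      proof (rule compact_space_common_point[OF compact closedin_diff[OF closedin_topspace U(1)]])
        show "closedin X {B \<in> topspace X. \<rho> a B \<in> {\<rho> a A}}" for a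
          using \<rho>_path[OF A] topspace_eq
          by (intro closedin_continuous_map_preimage[OF continuous_\<rho>] closedin_Hausdorff_singleton[OF Hausdorff]) simp
        fix J assume J: "finite J" "J \<subseteq> {..<\<omega>\<^sub>1}"
        \<comment> \<open>Inserting zero makes the maximum meaningful for empty \<open>J\<close>.
          The single path \<open>\<rho> m A\<close> then has the required restrictions for all of
          \<open>J\<close>.\<close>
        define m where "m = Max (insert 0 J)"
        have "m \<in> insert 0 J" unfolding m_def using J(1) by (intro Max_in) auto
        then have "m < \<omega>\<^sub>1" using J(2) omega1_pos by auto
        then have "\<rho> m A \<in> topspace X - U" using no \<rho>_path[OF A] by (auto simp: topspace_eq)
        moreover have "\<rho> a (\<rho> m A) = \<rho> a A" if "a \<in> J" for a
        proof -
          have "a \<le> m" unfolding m_def using J(1) that by simp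
          then show ?thesis using mem_\<rho>[OF \<rho>_path[OF A]] mem_\<rho>[OF A] by (auto intro: order_trans)
        qed
        ultimately show "\<exists>B\<in>topspace X - U. \<forall>a\<in>J. B \<in> {B \<in> topspace X. \<rho> a B \<in> {\<rho> a A}}"
          by auto
      qed
      then obtain B where B: "B \<in> paths T r" "B \<notin> U" "\<And>a. a < \<omega>\<^sub>1 \<Longrightarrow> \<rho> a B = \<rho> a A"
        by (auto simp: topspace_eq)
      have "t \<in> A \<longleftrightarrow> t \<in> B" for t
      proof (cases "t \<in> T")
        case True
        then show ?thesis using mem_\<rho>[OF A, of t "\<delta> t"] mem_\<rho>[OF B(1), of t "\<delta> t"] B(3)[OF grade_less] by simp
      next
        case False
        then show ?thesis using path_subset A B(1) by blast
      qed
      then have "A = B" by blast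
      then show False using B(2) U(2) by simp
    qed
    moreover have "\<rho> a A \<in> (\<Union>a\<in>{..<\<omega>\<^sub>1}. P a)" if "a < \<omega>\<^sub>1" for a
      using \<rho>_in_P[OF A order_refl, of a] that by auto
    ultimately have "\<exists>B\<in>\<Union>a\<in>{..<\<omega>\<^sub>1}. P a. B \<in> U" if "openin X U" "A \<in> U" for U
      using that by blast
    then show "A \<in> X closure_of (\<Union>a\<in>{..<\<omega>\<^sub>1}. P a)"
      using \<open>A \<in> topspace X\<close> unfolding in_closure_of by blast
  qed
qed

section \<open>Increments between consecutive levels\<close>

definition pred_grade :: "ordinal \<Rightarrow> ordinal" where
  "pred_grade a = (SOME b. b < a \<and> (\<forall>c<a. c \<le> b))"

lemma pred_grade:
  assumes "successor_ordinal a"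
  shows "pred_grade a < a" "\<And>c. c \<le> pred_grade a \<longleftrightarrow> c < a"
proof -
  have "\<exists>b. b < a \<and> (\<forall>c<a. c \<le> b)"
    using assms by (simp add: successor_ordinal_def)
  then have "pred_grade a < a \<and> (\<forall>c<a. c \<le> pred_grade a)"
    unfolding pred_grade_def by (rule someI_ex)
  then show "pred_grade a < a" "\<And>c. c \<le> pred_grade a \<longleftrightarrow> c < a" by auto
qed

lemma not_successor_zero: "\<not> successor_ordinal 0"
  by (simp add: successor_ordinal_def)

lemma mem_\<rho>_pred:
  "A \<in> paths T r \<Longrightarrow> successor_ordinal a \<Longrightarrow> t \<in> \<rho> (pred_grade a) A \<longleftrightarrow> t \<in> A \<and> \<delta> t < a"
  by (simp add: mem_\<rho> pred_grade)

lemma \<rho>_eq_\<rho>_pred_iff: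
  assumes A: "A \<in> paths T r" and a: "successor_ordinal a"
  shows "\<rho> a A = \<rho> (pred_grade a) A \<longleftrightarrow> a \<notin> \<delta> ` A"
  unfolding set_eq_iff mem_\<rho>_pred[OF A a] mem_\<rho>[OF A, of _ a] by (auto simp: le_less)

definition grades :: "ordinal set" where
  "grades = {a. a < \<omega>\<^sub>1 \<and> (successor_ordinal a \<or> a = 0)}"

text \<open>The increments between consecutive levels separate the paths, and an increment at grade \<open>a\<close>
  is nonzero on a path only if the path has a node of grade \<open>a\<close>; so the supports of countable paths
  are countable and those of uncountable paths are not.\<close>

lemma exists_increment_family:
  "\<exists>f :: ordinal \<times> nat \<Rightarrow> 't set \<Rightarrow> real. separating_family X (grades \<times> UNIV) f \<and>
    (\<forall>A\<in>paths T r. countable {i \<in> grades \<times> UNIV. f i A \<noteq> 0} \<longleftrightarrow> countable A)"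
proof -
  have "\<exists>F. separating_family (subtopology X (P a)) (UNIV :: nat set) F" if "a < \<omega>\<^sub>1" for a
    using compact_metrizable_separating[OF compact_P metrizable[OF that]] by metis
  then obtain F where F: "\<And>a. a < \<omega>\<^sub>1 \<Longrightarrow> separating_family (subtopology X (P a)) (UNIV :: nat set) (F a)"
    by metis
  \<comment> \<open>Grade zero has no preceding level, so there the increment is the full
    value.\<close>
  define f where "f = (\<lambda>(a, n) A. F a n (\<rho> a A) - (if a = 0 then 0 else F a n (\<rho> (pred_grade a) A)))"
  have F_sep: "B = C" if a: "a < \<omega>\<^sub>1" and BC: "B \<in> P a" "C \<in> P a" and eq: "\<And>n. F a n B = F a n C" for a B C
  proof (rule separating_family.separating[OF F[OF a]])
    show "B \<in> topspace (subtopology X (P a))" "C \<in> topspace (subtopology X (P a))"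
      by (simp_all only: topspace_P BC)
  qed (rule eq)
  have F_cont: "continuous_map X euclideanreal (\<lambda>A. F a n (\<rho> b A))" if "a < \<omega>\<^sub>1" "b \<le> a" for a b n
    using continuous_map_compose[OF continuous_\<rho>_P[OF that(2)] separating_family.cont[OF F[OF that(1)], of n]]
    by (simp add: o_def)
  have "separating_family X (grades \<times> UNIV) f"
  proof
    show "compact_space X" by (fact compact)
    show "continuous_map X euclideanreal (f i)" if i: "i \<in> grades \<times> UNIV" for i
    proof -
      obtain a n where an: "i = (a, n)" "a < \<omega>\<^sub>1" "successor_ordinal a \<or> a = 0"
        using i by (auto simp: grades_def)
      show ?thesis
      proof (cases "a = 0")
        case True
        then show ?thesis using F_cont[of 0 0 n] omega1_pos by (simp add: f_def an(1))
      next
        case False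
        then have "pred_grade a \<le> a" using an(3) pred_grade(1) by (simp add: less_imp_le)
        then show ?thesis
          using False F_cont[OF an(2)] by (auto simp: f_def an(1) intro!: continuous_map_diff)
      qed
    qed
    fix A B assume "A \<in> topspace X" "B \<in> topspace X" and eq: "\<And>i. i \<in> grades \<times> UNIV \<Longrightarrow> f i A = f i B"
    then have A: "A \<in> paths T r" and B: "B \<in> paths T r" by (auto simp: topspace_eq)
    show "A = B"
    proof (rule ccontr)
      \<comment> \<open>At a node \<open>t\<close> of least grade in the symmetric difference the
        paths agree below \<open>\<delta> t\<close>, so the subtracted terms coincide and the family
        at level \<open>\<delta> t\<close> identifies the two restrictions.\<close>
      let ?D = "(A - B) \<union> (B - A)"
      assume "A \<noteq> B"
      then have "\<exists>a. \<exists>t\<in>?D. \<delta> t = a" by blast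
      then have "\<exists>t\<in>?D. \<delta> t = (LEAST a. \<exists>t\<in>?D. \<delta> t = a)" by (rule LeastI_ex)
      then obtain t where t: "t \<in> ?D" and t_eq: "\<delta> t = (LEAST a. \<exists>t\<in>?D. \<delta> t = a)" by blast
      have least: "\<delta> t \<le> \<delta> s" if "s \<in> ?D" for s
        unfolding t_eq by (rule Least_le) (use that in blast)
      have tT: "t \<in> T" using t path_subset[OF A] path_subset[OF B] by blast
      have "f (\<delta> t, n) A = f (\<delta> t, n) B" for n
        using grade_less[OF tT] grade_cases[OF tT] by (intro eq) (simp add: grades_def)
      moreover have "\<rho> (pred_grade (\<delta> t)) A = \<rho> (pred_grade (\<delta> t)) B" if "\<delta> t \<noteq> 0"
      proof -
        have suc: "successor_ordinal (\<delta> t)" using that grade_cases[OF tT] by blast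
        have "s \<in> A \<longleftrightarrow> s \<in> B" if "\<delta> s < \<delta> t" for s
          using least[of s] that not_le[of "\<delta> t" "\<delta> s"] by blast
        then show ?thesis by (auto simp: mem_\<rho>_pred A B suc)
      qed
      ultimately have "F (\<delta> t) n (\<rho> (\<delta> t) A) = F (\<delta> t) n (\<rho> (\<delta> t) B)" for n
        by (cases "\<delta> t = 0") (auto simp: f_def)
      then have "\<rho> (\<delta> t) A = \<rho> (\<delta> t) B"
        using F_sep[OF grade_less[OF tT]] \<rho>_in_P A B by blast
      then have "t \<in> A \<longleftrightarrow> t \<in> B" using mem_\<rho>[OF A, of t "\<delta> t"] mem_\<rho>[OF B, of t "\<delta> t"] by simp
      then show False using t by blast
    qed
  qed
  moreover have "countable {i \<in> grades \<times> UNIV. f i A \<noteq> 0} \<longleftrightarrow> countable A"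
    if A: "A \<in> paths T r" for A
  proof
    \<comment> \<open>Both restrictions lie in \<open>P a\<close>, where \<open>F a\<close>
      separates points. So all increments at \<open>a\<close> vanish iff the two restrictions are
      equal.\<close>
    have step: "(\<exists>n. f (a, n) A \<noteq> 0) \<longleftrightarrow> (\<exists>t\<in>A. \<delta> t = a)" if a: "a < \<omega>\<^sub>1" "successor_ordinal a" for a
    proof -
      have ne: "a \<noteq> 0" using a(2) not_successor_zero by metis
      have "(\<forall>n. f (a, n) A = 0) \<longleftrightarrow> \<rho> a A = \<rho> (pred_grade a) A"
        using F_sep[OF a(1) \<rho>_in_P[OF A order_refl] \<rho>_in_P[OF A, of "pred_grade a" a]] pred_grade(1)[OF a(2)] ne
        by (auto simp: f_def less_imp_le)
      also have "\<dots> \<longleftrightarrow> \<not> (\<exists>t\<in>A. \<delta> t = a)"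
        using \<rho>_eq_\<rho>_pred_iff[OF A a(2)] by auto
      finally show ?thesis by blast
    qed
    assume "countable {i \<in> grades \<times> UNIV. f i A \<noteq> 0}"
    \<comment> \<open>Zero is added because the functions at grade zero may vanish on
      \<open>\<rho> 0 A\<close> although the path has a node of grade zero.\<close>
    then have "countable (insert 0 (fst ` {i \<in> grades \<times> UNIV. f i A \<noteq> 0}))" by simp
    moreover have "\<delta> ` A \<subseteq> insert 0 (fst ` {i \<in> grades \<times> UNIV. f i A \<noteq> 0})"
    proof
      fix a assume "a \<in> \<delta> ` A"
      then obtain t where t: "t \<in> A" "a = \<delta> t" by blast
      then have "t \<in> T" using path_subset[OF A] by blast
      then have a: "a < \<omega>\<^sub>1" "successor_ordinal a \<or> a = 0" using grade_less grade_cases t(2) by auto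
      show "a \<in> insert 0 (fst ` {i \<in> grades \<times> UNIV. f i A \<noteq> 0})"
      proof (cases "a = 0")
        case False
        then obtain n where "f (a, n) A \<noteq> 0" using step[of a] a t by blast
        then have "(a, n) \<in> {i \<in> grades \<times> UNIV. f i A \<noteq> 0}" using a by (simp add: grades_def)
        then show ?thesis by force
      qed simp
    qed
    ultimately have "countable (\<delta> ` A)" by (rule countable_subset[rotated])
    then show "countable A"
      using grade_inj_on_path[OF graded A] by (rule countable_image_inj_on)
  next
    assume "countable A"
    then have "countable (insert 0 (\<delta> ` A) \<times> (UNIV :: nat set))" by simp
    moreover have "{i \<in> grades \<times> UNIV. f i A \<noteq> 0} \<subseteq> insert 0 (\<delta> ` A) \<times> UNIV"
    proof
      fix i assume "i \<in> {i \<in> grades \<times> (UNIV :: nat set). f i A \<noteq> 0}"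
      then obtain a n where an: "i = (a, n)" "a < \<omega>\<^sub>1" "successor_ordinal a \<or> a = 0" "f (a, n) A \<noteq> 0"
        by (auto simp: grades_def)
      have "a \<in> \<delta> ` A" if "a \<noteq> 0"
      proof (rule ccontr)
        assume no: "a \<notin> \<delta> ` A"
        have suc: "successor_ordinal a" using an(3) that by blast
        have "\<rho> a A = \<rho> (pred_grade a) A"
          using \<rho>_eq_\<rho>_pred_iff[OF A suc] no by simp
        then show False using an(4) that by (simp add: f_def)
      qed
      then show "i \<in> insert 0 (\<delta> ` A) \<times> UNIV" using an(1) by auto
    qed
    ultimately show "countable {i \<in> grades \<times> UNIV. f i A \<noteq> 0}" by (rule countable_subset[rotated])
  qed
  ultimately show ?thesis by blast
qed

text \<open>The increments serve as coordinates: countable support singles out the countable paths,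
  and the bound on the number of pairs in \<open>grades \<times> UNIV\<close> bounds the
  weight.\<close>

theorem Valdivia_paths:
  "Valdivia X" "weight X \<le>o cardSuc natLeq" "Sigma_subset X (\<Union>a\<in>{..<\<omega>\<^sub>1}. P a)"
proof -
  obtain f :: "ordinal \<times> nat \<Rightarrow> 't set \<Rightarrow> real" where sep: "separating_family X (grades \<times> UNIV) f"
    and supp: "\<forall>A\<in>paths T r. countable {i \<in> grades \<times> UNIV. f i A \<noteq> 0} \<longleftrightarrow> countable A"
    using exists_increment_family by blast
  have "(\<Union>a\<in>{..<\<omega>\<^sub>1}. P a) = {A \<in> topspace X. countable {i \<in> grades \<times> UNIV. f i A \<noteq> 0}}"
    unfolding UN_paths_level_eq_countable_paths[OF below] topspace_eq using supp by blast
  then show sigma: "Sigma_subset X (\<Union>a\<in>{..<\<omega>\<^sub>1}. P a)"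
    using separating_family.Sigma_subset_countable_support[OF sep] by simp
  then show "Valdivia X"
    using compact Hausdorff dense_countable_paths by (auto simp: Valdivia_def)
  show "weight X \<le>o cardSuc natLeq"
  proof (rule separating_family.weight_le_omega1[OF sep])
    have "|{..<\<omega>\<^sub>1}| \<le>o cardSuc natLeq" using card_of_lessThan_omega1 ordIso_iff_ordLeq by blast
    then have "|\<Union>a\<in>{..<\<omega>\<^sub>1}. {a} \<times> (UNIV :: nat set)| \<le>o cardSuc natLeq"
      by (rule card_UN_countable_le_omega1) simp
    moreover have "grades \<times> (UNIV :: nat set) \<subseteq> (\<Union>a\<in>{..<\<omega>\<^sub>1}. {a} \<times> UNIV)"
      by (auto simp: grades_def)
    ultimately show "|grades \<times> (UNIV :: nat set)| \<le>o cardSuc natLeq"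
      by (meson card_of_mono1 ordLeq_transitive)
  qed
qed

end

theorem theorem3p4:
  shows
   "(\<forall>(K :: 'a topology) S.
       Valdivia K \<and> weight K \<le>o cardSuc natLeq \<and> Sigma_subset K S \<and> dense_in K S \<longrightarrow>
       (\<exists>(T :: 'a set) r \<delta> X g.
          graded_tree_below \<omega>\<^sub>1 T r \<delta> \<and>
          compatible_topology T r \<delta> X \<and>
          (\<forall>\<alpha><\<omega>\<^sub>1. metrizable_space (subtopology X (paths (level T \<delta> \<alpha>) r))) \<and>
          homeomorphic_map K X g \<and>
          g ` S = (\<Union>\<alpha>\<in>{..<\<omega>\<^sub>1}. paths (level T \<delta> \<alpha>) r) \<and>
          (\<Union>\<alpha>\<in>{..<\<omega>\<^sub>1}. paths (level T \<delta> \<alpha>) r) = {A \<in> paths T r. countable A})) \<and>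
    (\<forall>(T :: 't set) r \<delta> X.
       graded_tree_below \<omega>\<^sub>1 T r \<delta> \<and>
       compatible_topology T r \<delta> X \<and>
       (\<forall>\<alpha><\<omega>\<^sub>1. metrizable_space (subtopology X (paths (level T \<delta> \<alpha>) r))) \<longrightarrow>
       Valdivia X \<and>
       weight X \<le>o cardSuc natLeq \<and>
       (\<Union>\<alpha>\<in>{..<\<omega>\<^sub>1}. paths (level T \<delta> \<alpha>) r) = {A \<in> paths T r. countable A} \<and>
       Sigma_subset X (\<Union>\<alpha>\<in>{..<\<omega>\<^sub>1}. paths (level T \<delta> \<alpha>) r) \<and>
       dense_in X (\<Union>\<alpha>\<in>{..<\<omega>\<^sub>1}. paths (level T \<delta> \<alpha>) r))"
proof (intro conjI allI impI; (elim conjE)?)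
  fix K :: "'a topology" and S
  assume "Valdivia K" "weight K \<le>o cardSuc natLeq" "Sigma_subset K S" "dense_in K S"
  then show "\<exists>(T :: 'a set) r \<delta> X g.
      graded_tree_below \<omega>\<^sub>1 T r \<delta> \<and>
      compatible_topology T r \<delta> X \<and>
      (\<forall>\<alpha><\<omega>\<^sub>1. metrizable_space (subtopology X (paths (level T \<delta> \<alpha>) r))) \<and>
      homeomorphic_map K X g \<and>
      g ` S = (\<Union>\<alpha>\<in>{..<\<omega>\<^sub>1}. paths (level T \<delta> \<alpha>) r) \<and>
      (\<Union>\<alpha>\<in>{..<\<omega>\<^sub>1}. paths (level T \<delta> \<alpha>) r) = {A \<in> paths T r. countable A}"
    by (rule Valdivia_tree_representation)
next
  fix T :: "'t set" and r \<delta> X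
  assume *: "graded_tree_below \<omega>\<^sub>1 T r \<delta>" "compatible_topology T r \<delta> X"
    "\<forall>\<alpha><\<omega>\<^sub>1. metrizable_space (subtopology X (paths (level T \<delta> \<alpha>) r))"
  interpret compatible_tree T r \<delta> X
    using * by unfold_locales auto
  show "Valdivia X" "weight X \<le>o cardSuc natLeq"
    "(\<Union>\<alpha>\<in>{..<\<omega>\<^sub>1}. paths (level T \<delta> \<alpha>) r) = {A \<in> paths T r. countable A}"
    "Sigma_subset X (\<Union>\<alpha>\<in>{..<\<omega>\<^sub>1}. paths (level T \<delta> \<alpha>) r)"
    "dense_in X (\<Union>\<alpha>\<in>{..<\<omega>\<^sub>1}. paths (level T \<delta> \<alpha>) r)"
    by (fact Valdivia_paths UN_paths_level_eq_countable_paths[OF below] dense_countable_paths)+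
qed

end
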